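(* Let $X$ be a nearly uniformly convex Banach space, let $C$ be a closed convex bounded nonempty subset of $X$, and let $T:C\to C$ be an asymptotically nonexpansive type mapping. Let $K$ be a closed convex nonempty subset of $C$ such that $\omega_w(x)\subset K$ for every $x\in K$, and such that $K$ is minimal (with respect to inclusion) among the closed convex nonempty subsets of $C$ with this property. Then $K$ is a singleton $\{x_0\}$ and the sequence $\{T^nx_0\}$ is norm convergent to $x_0$. In particular, every pointwise asymptotically nonexpansive mapping $T:C\to C$ has a fixed point.
   Context: Let $(X,\Vert\cdot\Vert)$ be a Banach space with closed unit ball $B(0,1)$. The Kuratowski measure of noncompactness of a nonempty bounded set $A\subset X$ is $\alpha(A)=\inf\{\varepsilon>0: A$ can be covered by finitely many sets of diameter smaller than $\varepsilon\}$. The modulus of noncompact convexity associated to $\alpha$ is $\Delta_\alpha(\varepsilon)=\inf\{1-d(0,A): A\subset B(0,1)\text{ convex},\ \alpha(A)\ge\varepsilon\}$ (with $\inf\emptyset=+\infty$), where $d(0,A)=\inf_{a\in A}\Vert a\Vert$; the characteristic of noncompact convexity is $\varepsilon_\alpha(X)=\sup\{\varepsilon\ge0:\Delta_\alpha(\varepsilon)=0\}$. The space $X$ is nearly uniformly convex if $\varepsilon_\alpha(X)=0$. Let $C\subset X$ be nonempty and $T:C\to C$ (no continuity is assumed); $T^n$ denotes the $n$-th iterate. $T$ is an asymptotically nonexpansive type mapping if for each $x\in C$, $\limsup_{n\to\infty}\bigl\{\sup\{\Vert T^nx-T^ny\Vert-\Vert x-y\Vert: y\in C\}\bigr\}\le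 0$. $T$ is pointwise asymptotically nonexpansive if for each $x\in C$ there exist $N(x)\in\mathbb{N}$ and a real sequence $(\alpha_n(x))_n$ with $\lim_n\alpha_n(x)=1$ such that for all $n\ge N(x)$, $\Vert T^nx-T^ny\Vert\le\alpha_n(x)\Vert x-y\Vert$ for all $y\in C$. For $x\in C$, $\omega_w(x)$ denotes the set of cluster points of the sequence $\{T^nx\}$ in the weak topology. *)

theory Defs
  imports "HOL-Analysis.Analysis"
begin

text \<open>The constant diameter takes real values and is unspecified on unbounded sets, hence the
  explicit boundedness of the covering sets.\<close>

definition kuratowski_mnc :: "'a::metric_space set \<Rightarrow> real" where
  "kuratowski_mnc A = Inf {\<epsilon>. \<epsilon> > 0 \<and>
     (\<exists>\<F>. finite \<F> \<and> A \<subseteq> \<Union>\<F> \<and> (\<forall>S\<in>\<F>. bounded S \<and> diameter S < \<epsilon>))}"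

text \<open>The infimum is taken in the extended reals, so that the infimum of the empty set
  is \<open>\<infinity>\<close>.\<close>

definition modulus_noncompact_convexity :: "'a::real_normed_vector itself \<Rightarrow> real \<Rightarrow> ereal" where
  "modulus_noncompact_convexity _ \<epsilon> =
     (INF A\<in>{A :: 'a set. A \<noteq> {} \<and> A \<subseteq> cball 0 1 \<and> convex A \<and> kuratowski_mnc A \<ge> \<epsilon>}.
        ereal (1 - infdist 0 A))"

text \<open>The supremum is taken in \<open>[0, \<infinity>]\<close>. The only space for which the set below is empty is the
  zero space, whose characteristic is therefore 0.\<close>

definition char_noncompact_convexity :: "'a::real_normed_vector itself \<Rightarrow> ennreal" where
  "char_noncompact_convexity X =
     (SUP \<epsilon>\<in>{\<epsilon>. \<epsilon> \<ge> 0 \<and> modulus_noncompact_convexity X \<epsilon> = 0}. ennreal \<epsilon>)"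

definition nearly_uniformly_convex :: "'a::real_normed_vector itself \<Rightarrow> bool" where
  "nearly_uniformly_convex X \<longleftrightarrow> char_noncompact_convexity X = 0"

definition asymptotically_nonexpansive_type ::
    "'a::real_normed_vector set \<Rightarrow> ('a \<Rightarrow> 'a) \<Rightarrow> bool" where
  "asymptotically_nonexpansive_type C T \<longleftrightarrow>
     (\<forall>x\<in>C. limsup (\<lambda>n. SUP y\<in>C.
        ereal (norm ((T ^^ n) x - (T ^^ n) y) - norm (x - y))) \<le> 0)"

definition pointwise_asymptotically_nonexpansive ::
    "'a::real_normed_vector set \<Rightarrow> ('a \<Rightarrow> 'a) \<Rightarrow> bool" where
  "pointwise_asymptotically_nonexpansive C T \<longleftrightarrow>
     (\<forall>x\<in>C. \<exists>(N::nat) (a :: nat \<Rightarrow> real). a \<longlonglongrightarrow> 1 \<and>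
        (\<forall>n\<ge>N. \<forall>y\<in>C. norm ((T ^^ n) x - (T ^^ n) y) \<le> a n * norm (x - y)))"

definition weak_topology :: "'a::real_normed_vector topology" where
  "weak_topology = topology_generated_by
     {f -` U | (f :: 'a \<Rightarrow> real) U. bounded_linear f \<and> open U}"

definition cluster_points :: "'a topology \<Rightarrow> (nat \<Rightarrow> 'a) \<Rightarrow> 'a set" where
  "cluster_points X s = {y \<in> topspace X.
     \<forall>U. openin X U \<and> y \<in> U \<longrightarrow> (\<exists>\<^sub>F n in sequentially. s n \<in> U)}"

definition weak_omega_limit :: "('a::real_normed_vector \<Rightarrow> 'a) \<Rightarrow> 'a \<Rightarrow> 'a set" where
  "weak_omega_limit T x = cluster_points weak_topology (\<lambda>n. (T ^^ n) x)"

definition weak_omega_closed_convex ::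
    "'a::real_normed_vector set \<Rightarrow> ('a \<Rightarrow> 'a) \<Rightarrow> 'a set \<Rightarrow> bool" where
  "weak_omega_closed_convex C T K \<longleftrightarrow>
     K \<subseteq> C \<and> K \<noteq> {} \<and> closed K \<and> convex K \<and> (\<forall>x\<in>K. weak_omega_limit T x \<subseteq> K)"

end

theory Submission
  imports Defs
begin

text \<open>Let \<open>K\<close> be minimal. For \<open>x \<in> C\<close> the asymptotic radius \<open>v \<mapsto> limsup \<parallel>(T ^^ n) x - v\<parallel>\<close> is
  convex and continuous, and it does not increase asymptotically along orbits because \<open>T\<close> is of
  asymptotically nonexpansive type. Its sublevel sets in \<open>K\<close> are therefore closed under weak
  \<open>\<omega>\<close>-limits, and minimality makes it a constant \<open>r\<close> on \<open>K\<close>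
  (\<open>asymptotic_radius_constant_on_minimal\<close>).

  Now take \<open>x \<in> K\<close> and \<open>s n = (T ^^ n) x\<close>. Since \<open>x\<close> lies in \<open>K\<close>, the distances \<open>\<parallel>s m - s n\<parallel>\<close> are
  asymptotically at most \<open>r\<close> too, for \<open>n\<close> large and \<open>m\<close> large depending on \<open>n\<close>. Suppose \<open>r > 0\<close>. If
  some subsequence of \<open>s\<close> had no norm convergent subsequence, near uniform convexity, applied in
  balls centred at the points \<open>s n\<close> themselves, would bring a weak cluster point \<open>w\<close> closer than
  \<open>r\<close> to almost all \<open>s n\<close>; but \<open>w \<in> K\<close>, where the radius is \<open>r\<close>
  (\<open>equidistant_sequence_norm_limit\<close>). So \<open>s\<close> is relatively compact in norm, and the normal
  structure of compact convex sets excludes that a sequence with cluster points in \<open>K\<close> has a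
  constant positive asymptotic radius on \<open>K\<close> (\<open>equidistant_sequence_radius_zero\<close>). Hence
  \<open>r = 0\<close>, which means that \<open>s\<close> converges to every point of \<open>K\<close>.

  A pointwise asymptotically nonexpansive \<open>T\<close> on a bounded set is of asymptotically nonexpansive
  type. Zorn's lemma provides a minimal \<open>K\<close>, and the limit of the orbit of its only point is fixed by
  all iterates of large order, hence by \<open>T\<close>.

  Reflexivity enters as an intersection theorem: in a nearly uniformly convex space, a downward
  directed family of nonempty bounded closed convex sets has a common point
  (\<open>nuc_directed_intersection\<close>). Weak limits are taken along ultrafilters, which replaces the passage to
  weakly convergent subsequences. That closed convex sets are weakly closed is the
  Hahn-Banach theorem, proved here by means of minimal sublinear functionals.\<close>

section \<open>Ultrafilters\<close>

definition ultrafilter :: "'a filter \<Rightarrow> bool" where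
  "ultrafilter U \<longleftrightarrow> U \<noteq> bot \<and> (\<forall>P. eventually P U \<or> eventually (\<lambda>x. \<not> P x) U)"

text \<open>In the order on filters, ultrafilters are the minimal filters other than the improper one,
  so Zorn's lemma provides them: a chain of proper filters generates a proper filter.\<close>

lemma ultrafilter_exists:
  fixes F :: "'a filter"
  assumes "F \<noteq> bot"
  shows "\<exists>U\<le>F. ultrafilter U"
proof -
  define A where "A = {G. G \<le> F \<and> G \<noteq> bot}"
  define P where "P = (\<lambda>G G' :: 'a filter. G' \<le> G)"
  have "\<exists>u\<in>A. \<forall>a\<in>\<C>. P a u" if C: "\<C> \<in> Chains (relation_of P A)" for \<C>
  proof (cases "\<C> = {}")
    case True
    then show ?thesis using assms by (auto simp: A_def)
  next
    case False
    have CA: "\<C> \<subseteq> A"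
      using C by (auto simp: Chains_def relation_of_def)
    have lin: "G \<le> G' \<or> G' \<le> G" if "G \<in> \<C>" "G' \<in> \<C>" for G G'
      using C that by (auto simp: Chains_def relation_of_def P_def)
    have base: "\<exists>x\<in>\<C>. x \<le> inf G G'" if "G \<in> \<C>" "G' \<in> \<C>" for G G'
      using lin[OF that] that by (metis inf.absorb1 inf.absorb2 order_refl)
    have "Inf \<C> \<noteq> bot"
      using False CA eventually_Inf_base[OF False base, of "\<lambda>_. False"]
      by (auto simp: A_def trivial_limit_def)
    moreover have "Inf \<C> \<le> F"
      using False CA by (auto simp: A_def intro: Inf_lower2)
    ultimately show ?thesis
      by (auto simp: A_def P_def intro!: bexI[of _ "Inf \<C>"] Inf_lower)
  qed
  moreover have "partial_order_on A (relation_of P A)"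
    by (auto simp: partial_order_on_def preorder_on_def refl_on_def trans_def antisym_def
        relation_of_def P_def)
  ultimately obtain U where U: "U \<in> A" and min: "\<And>G. G \<in> A \<Longrightarrow> G \<le> U \<Longrightarrow> G = U"
    using predicate_Zorn[of A P] by (auto simp: P_def)
  have "eventually P U \<or> eventually (\<lambda>x. \<not> P x) U" for P
  proof (cases "inf U (principal {x. P x}) = bot")
    case True
    then show ?thesis
      by (simp add: trivial_limit_def eventually_inf_principal)
  next
    case False
    then have "inf U (principal {x. P x}) = U"
      using U by (intro min) (auto simp: A_def intro: le_infI1)
    then have "U \<le> principal {x. P x}"
      by (metis inf.cobounded2)
    then show ?thesis
      by (simp add: le_principal)
  qed
  then show ?thesis
    using U by (auto simp: A_def ultrafilter_def)
qed

lemma ultrafilter_finite_Union: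
  assumes "ultrafilter U" "finite k" "eventually (\<lambda>x. x \<in> (\<Union>i\<in>k. B i)) U"
  shows "\<exists>i\<in>k. eventually (\<lambda>x. x \<in> B i) U"
proof (rule ccontr)
  assume "\<not> (\<exists>i\<in>k. eventually (\<lambda>x. x \<in> B i) U)"
  then have "\<forall>i\<in>k. eventually (\<lambda>x. x \<notin> B i) U"
    using assms(1) by (auto simp: ultrafilter_def)
  then have "eventually (\<lambda>x. \<forall>i\<in>k. x \<notin> B i) U"
    using assms(2) by (simp add: eventually_ball_finite_distrib)
  with assms(3) have "eventually (\<lambda>x. False) U"
    by eventually_elim auto
  then show False
    using assms(1) by (simp add: ultrafilter_def trivial_limit_def)
qed

lemma small_balls_imp_convergent:
  fixes U :: "'a::complete_space filter"
  assumes "U \<noteq> bot" and small: "\<And>\<epsilon>. \<epsilon> > 0 \<Longrightarrow> \<exists>p. eventually (\<lambda>x. x \<in> cball p \<epsilon>) U"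
  shows "\<exists>l. U \<le> nhds l"
proof -
  have "cauchy_filter U"
    unfolding cauchy_filter_metric
  proof (intro allI impI)
    fix e :: real assume "e > 0"
    then obtain p where "eventually (\<lambda>x. x \<in> cball p (e/3)) U"
      using small[of "e/3"] by auto
    moreover have "dist x y < e" if "x \<in> cball p (e/3)" "y \<in> cball p (e/3)" for x y
      using that \<open>e > 0\<close> dist_triangle3[of x y p] by simp
    ultimately show "\<exists>P. eventually P U \<and> (\<forall>x y. P x \<and> P y \<longrightarrow> dist x y < e)"
      by blast
  qed
  moreover have "complete (UNIV :: 'a set)"
    by (rule complete_UNIV)
  ultimately show ?thesis
    using assms(1) unfolding complete_uniform by (metis principal_UNIV top_greatest)
qed

section \<open>Finite nets and decreasing families of sets\<close>

definition finite_net :: "real \<Rightarrow> 'a::metric_space set \<Rightarrow> bool" where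
  "finite_net \<epsilon> A \<longleftrightarrow> (\<exists>k. finite k \<and> A \<subseteq> (\<Union>x\<in>k. cball x \<epsilon>))"

lemma finite_net_mono:
  assumes "finite_net \<epsilon> A" "B \<subseteq> A" "\<epsilon> \<le> \<epsilon>'"
  shows "finite_net \<epsilon>' B"
proof -
  obtain k where k: "finite k" "A \<subseteq> (\<Union>x\<in>k. cball x \<epsilon>)"
    using assms(1) by (auto simp: finite_net_def)
  have "(\<Union>x\<in>k. cball x \<epsilon>) \<subseteq> (\<Union>x\<in>k. cball x \<epsilon>')"
    using assms(3) by (auto intro: order_trans)
  then have "B \<subseteq> (\<Union>x\<in>k. cball x \<epsilon>')"
    using k(2) assms(2) by (meson order_trans)
  then show ?thesis
    using k(1) unfolding finite_net_def by (intro exI conjI)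
qed

text \<open>An ultrafilter that contains all members of the family concentrates, for each radius, on one
  ball of a finite net of some member. It is therefore Cauchy, and its limit lies in every member.\<close>

lemma kuratowski_intersection:
  fixes \<G> :: "'a::complete_space set set"
  assumes "\<G> \<noteq> {}" and closed: "\<And>A. A \<in> \<G> \<Longrightarrow> closed A" and nonempty: "{} \<notin> \<G>"
    and directed: "\<And>A B. A \<in> \<G> \<Longrightarrow> B \<in> \<G> \<Longrightarrow> \<exists>D\<in>\<G>. D \<subseteq> A \<inter> B"
    and net: "\<And>\<epsilon>. \<epsilon> > 0 \<Longrightarrow> \<exists>A\<in>\<G>. finite_net \<epsilon> A"
  shows "\<Inter>\<G> \<noteq> {}"
proof -
  define F where "F = Inf (principal ` \<G>)"
  have base: "\<exists>x\<in>principal ` \<G>. x \<le> inf a b" if "a \<in> principal ` \<G>" "b \<in> principal ` \<G>" for a b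
    using that directed by (fastforce simp: le_inf_iff)
  have "F \<noteq> bot"
    using assms(1) nonempty eventually_Inf_base[of "principal ` \<G>" "\<lambda>_. False", OF _ base]
    by (auto simp: F_def trivial_limit_def eventually_principal)
  then obtain U where U: "U \<le> F" "ultrafilter U"
    using ultrafilter_exists by blast
  have mem: "eventually (\<lambda>x. x \<in> A) U" if "A \<in> \<G>" for A
  proof -
    have "U \<le> principal A"
      using U(1) that by (auto simp: F_def intro: order_trans Inf_lower)
    then show ?thesis
      by (simp add: le_principal)
  qed
  have "\<exists>p. eventually (\<lambda>x. x \<in> cball p \<epsilon>) U" if \<epsilon>: "\<epsilon> > 0" for \<epsilon>
  proof -
    obtain A k where A: "A \<in> \<G>" "finite k" "A \<subseteq> (\<Union>x\<in>k. cball x \<epsilon>)"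
      using net[OF \<epsilon>] by (auto simp: finite_net_def)
    have "eventually (\<lambda>x. x \<in> (\<Union>x\<in>k. cball x \<epsilon>)) U"
      using mem[OF A(1)] by (rule eventually_mono) (rule subsetD[OF A(3)])
    from ultrafilter_finite_Union[OF U(2) A(2) this] show ?thesis
      by blast
  qed
  then obtain l where l: "U \<le> nhds l"
    using small_balls_imp_convergent U(2) by (metis ultrafilter_def)
  have "l \<in> A" if A: "A \<in> \<G>" for A
  proof (rule Lim_in_closed_set[OF closed[OF A], of "\<lambda>x. x" U])
    show "eventually (\<lambda>x. x \<in> A) U" "U \<noteq> bot" "((\<lambda>x. x) \<longlongrightarrow> l) U"
      using mem[OF A] U(2) l by (auto simp: ultrafilter_def filterlim_def)
  qed
  then show ?thesis
    by blast
qed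

section \<open>Nearly uniformly convex spaces\<close>

lemma infdist_less_imp:
  assumes "infdist x A < t" "A \<noteq> {}"
  shows "\<exists>a\<in>A. dist x a < t"
proof -
  have "(INF a\<in>A. dist x a) < t"
    using assms by (simp add: infdist_def)
  then show ?thesis
    using assms(2) by (subst (asm) cINF_less_iff) auto
qed

lemma finite_net_if_kuratowski_less:
  assumes "bounded A" "kuratowski_mnc A < \<epsilon>"
  shows "finite_net \<epsilon> A"
proof -
  define E where "E = {\<epsilon>. \<epsilon> > 0 \<and> (\<exists>\<F>. finite \<F> \<and> A \<subseteq> \<Union>\<F> \<and> (\<forall>S\<in>\<F>. bounded S \<and> diameter S < \<epsilon>))}"
  have "diameter A + 1 \<in> E"
    using assms(1) diameter_ge_0[OF assms(1)] by (auto simp: E_def intro!: exI[of _ "{A}"])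
  then have "E \<noteq> {}"
    by blast
  moreover have "Inf E < \<epsilon>"
    using assms(2) unfolding kuratowski_mnc_def E_def .
  ultimately obtain e where "e \<in> E" "e < \<epsilon>"
    by (metis cInf_lessD)
  then obtain \<F> where e: "e < \<epsilon>" and F: "finite \<F>" "A \<subseteq> \<Union>\<F>"
      "\<And>S. S \<in> \<F> \<Longrightarrow> bounded S \<and> diameter S < e"
    by (auto simp: E_def)
  have "S \<subseteq> cball (SOME x. x \<in> S) \<epsilon>" if "S \<in> \<F>" for S
  proof
    fix y assume "y \<in> S"
    then have "(SOME x. x \<in> S) \<in> S"
      by (rule someI)
    then have "dist (SOME x. x \<in> S) y \<le> diameter S"
      using F(3)[OF that] \<open>y \<in> S\<close> diameter_bounded_bound by blast
    then show "y \<in> cball (SOME x. x \<in> S) \<epsilon>"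
      using F(3)[OF that] e by auto
  qed
  then have "\<Union>\<F> \<subseteq> (\<Union>S\<in>\<F>. cball (SOME x. x \<in> S) \<epsilon>)"
    by (intro Union_least) (rule order_trans, assumption, rule UN_upper)
  then have "A \<subseteq> (\<Union>x\<in>(\<lambda>S. SOME x. x \<in> S) ` \<F>. cball x \<epsilon>)"
    using F(2) by (simp add: order_trans)
  moreover have "finite ((\<lambda>S. SOME x. x \<in> S) ` \<F>)"
    using F(1) by simp
  ultimately show ?thesis
    unfolding finite_net_def by (intro exI conjI)
qed

text \<open>The modulus of noncompact convexity is positive at each positive argument, and rescaling
  carries this from the unit ball to all balls.\<close>

lemma nuc_convex_subset_near_center:
  assumes nuc: "nearly_uniformly_convex TYPE('a::real_normed_vector)" and "\<epsilon> > 0"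
  obtains c where "0 < c" "c < 1"
    "\<And>(p::'a) \<rho> A. \<lbrakk>\<rho> > 0; convex A; A \<noteq> {}; A \<subseteq> cball p \<rho>; \<not> finite_net (\<epsilon> * \<rho>) A\<rbrakk> \<Longrightarrow>
       \<exists>a\<in>A. dist p a < (1 - c) * \<rho>"
proof -
  let ?\<A> = "{A :: 'a set. A \<noteq> {} \<and> A \<subseteq> cball 0 1 \<and> convex A \<and> kuratowski_mnc A \<ge> \<epsilon>}"
  let ?\<Delta> = "modulus_noncompact_convexity TYPE('a) \<epsilon>"
  have "?\<Delta> \<noteq> 0"
  proof
    assume "?\<Delta> = 0"
    then have "ennreal \<epsilon> \<le> char_noncompact_convexity TYPE('a)"
      unfolding char_noncompact_convexity_def using \<open>\<epsilon> > 0\<close> by (intro SUP_upper) auto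
    then show False
      using nuc \<open>\<epsilon> > 0\<close> by (simp add: nearly_uniformly_convex_def)
  qed
  moreover have "?\<Delta> \<ge> 0"
    unfolding modulus_noncompact_convexity_def
  proof (rule INF_greatest)
    fix A :: "'a set" assume "A \<in> ?\<A>"
    then obtain a where "a \<in> A" "A \<subseteq> cball 0 1"
      by auto
    then have "a \<in> A" "norm a \<le> 1"
      by auto
    then show "0 \<le> ereal (1 - infdist 0 A)"
      using infdist_le2[of a A 0 1] by simp
  qed
  ultimately have "0 < ?\<Delta>"
    by simp
  then obtain d where d: "0 < d" "ereal d < ?\<Delta>"
    using ereal_dense2[of 0 ?\<Delta>] by auto
  define c where "c = min (1/2) (d/2)"
  have c: "0 < c" "c < 1" "c < d"
    using d(1) by (auto simp: c_def)
  show thesis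
  proof (rule that[OF c(1,2)])
    fix p :: 'a and \<rho> :: real and A
    assume A: "\<rho> > 0" "convex A" "A \<noteq> {}" "A \<subseteq> cball p \<rho>" "\<not> finite_net (\<epsilon> * \<rho>) A"
    define A' where "A' = (\<lambda>a. (1/\<rho>) *\<^sub>R (a - p)) ` A"
    have ball: "A' \<subseteq> cball 0 1"
      using A(1,4) by (auto simp: A'_def dist_norm norm_minus_commute divide_simps)
    have "A' = (\<lambda>a. - (1/\<rho>) *\<^sub>R p + (1/\<rho>) *\<^sub>R a) ` A"
      unfolding A'_def by (intro image_cong refl) (simp add: algebra_simps)
    then have conv: "convex A'"
      using convex_affinity[OF A(2)] by (simp only:)
    have "\<not> finite_net \<epsilon> A'"
    proof
      assume "finite_net \<epsilon> A'"
      then obtain k where k: "finite k" "A' \<subseteq> (\<Union>x\<in>k. cball x \<epsilon>)"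
        by (auto simp: finite_net_def)
      have "A \<subseteq> (\<Union>x\<in>(\<lambda>x. p + \<rho> *\<^sub>R x) ` k. cball x (\<epsilon> * \<rho>))"
      proof
        fix a assume "a \<in> A"
        then have "(1/\<rho>) *\<^sub>R (a - p) \<in> A'"
          by (auto simp: A'_def)
        then obtain x where x: "x \<in> k" "dist x ((1/\<rho>) *\<^sub>R (a - p)) \<le> \<epsilon>"
          using k(2) by auto
        have "(p + \<rho> *\<^sub>R x) - a = \<rho> *\<^sub>R (x - (1/\<rho>) *\<^sub>R (a - p))"
          using A(1) by (simp add: algebra_simps)
        then have "dist (p + \<rho> *\<^sub>R x) a = \<rho> * dist x ((1/\<rho>) *\<^sub>R (a - p))"
          using A(1) by (simp add: dist_norm)
        also have "\<dots> \<le> \<epsilon> * \<rho>"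
          using x(2) A(1) by (simp add: mult.commute)
        finally show "a \<in> (\<Union>x\<in>(\<lambda>x. p + \<rho> *\<^sub>R x) ` k. cball x (\<epsilon> * \<rho>))"
          using x(1) by auto
      qed
      moreover have "finite ((\<lambda>x. p + \<rho> *\<^sub>R x) ` k)"
        using k(1) by simp
      ultimately have "finite_net (\<epsilon> * \<rho>) A"
        unfolding finite_net_def by (intro exI conjI)
      then show False
        using A(5) by simp
    qed
    moreover have "bounded A'"
      using ball bounded_cball bounded_subset by blast
    ultimately have "kuratowski_mnc A' \<ge> \<epsilon>"
      using finite_net_if_kuratowski_less by (meson not_le)
    then have "A' \<in> ?\<A>"
      using ball conv A(3) by (auto simp: A'_def)
    then have "?\<Delta> \<le> ereal (1 - infdist 0 A')"
      unfolding modulus_noncompact_convexity_def by (rule INF_lower)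
    with d(2) have "ereal d < ereal (1 - infdist 0 A')"
      by (rule less_le_trans)
    then have "infdist 0 A' < 1 - c"
      using c(3) by simp
    then obtain a where a: "a \<in> A" "norm ((1/\<rho>) *\<^sub>R (a - p)) < 1 - c"
      using infdist_less_imp[of 0 A'] A(3) by (auto simp: A'_def)
    then have "dist p a < (1 - c) * \<rho>"
      using A(1) by (simp add: dist_norm norm_minus_commute divide_simps)
    then show "\<exists>a\<in>A. dist p a < (1 - c) * \<rho>"
      using a(1) by blast
  qed
qed

text \<open>This is the form in which reflexivity is used. Intersecting the sets with balls whose radii
  shrink to the limiting distance \<open>d\<close> from the origin leaves convex sets that lie in a ball and
  almost miss the smaller concentric balls; near uniform convexity gives them small finite nets.\<close>

lemma nuc_directed_intersection:
  fixes \<A> :: "'a::banach set set"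
  assumes nuc: "nearly_uniformly_convex TYPE('a)"
    and "\<A> \<noteq> {}" and nonempty: "{} \<notin> \<A>"
    and sets: "\<And>A. A \<in> \<A> \<Longrightarrow> closed A \<and> convex A \<and> A \<subseteq> C" and "bounded C"
    and directed: "\<And>A B. A \<in> \<A> \<Longrightarrow> B \<in> \<A> \<Longrightarrow> \<exists>D\<in>\<A>. D \<subseteq> A \<inter> B"
  shows "\<Inter>\<A> \<noteq> {}"
proof -
  define d where "d = (SUP A\<in>\<A>. infdist 0 A)"
  obtain M where M: "\<And>x. x \<in> C \<Longrightarrow> norm x \<le> M"
    using \<open>bounded C\<close> by (auto simp: bounded_iff)
  have "infdist 0 A \<le> M" if A: "A \<in> \<A>" for A
  proof -
    obtain a where "a \<in> A"
      using A nonempty by fastforce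
    then show ?thesis
      using infdist_le2[of a A 0 M] M sets[OF A] by auto
  qed
  then have bdd: "bdd_above (infdist 0 ` \<A>)"
    by (rule bdd_aboveI2)
  have d: "infdist 0 A \<le> d" if "A \<in> \<A>" for A
    unfolding d_def using that bdd by (rule cSUP_upper)
  have "d \<ge> 0"
    using \<open>\<A> \<noteq> {}\<close> d infdist_nonneg order_trans by (metis ex_in_conv)
  show ?thesis
  proof (cases "d = 0")
    case True
    then have "0 \<in> A" if "A \<in> \<A>" for A
      using d[OF that] infdist_nonneg[of 0 A] sets[OF that] nonempty that
      by (metis in_closed_iff_infdist_zero order_antisym)
    then show ?thesis
      by blast
  next
    case False
    with \<open>d \<ge> 0\<close> have "d > 0"
      by simp
    define \<G> where "\<G> = {A \<inter> cball 0 \<rho> | A \<rho>. A \<in> \<A> \<and> \<rho> > d}"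
    have "\<Inter>\<G> \<noteq> {}"
    proof (rule kuratowski_intersection)
      show "\<G> \<noteq> {}"
        using \<open>\<A> \<noteq> {}\<close> gt_ex[of d] by (auto simp: \<G>_def)
      show "closed B" if "B \<in> \<G>" for B
        using that sets by (auto simp: \<G>_def)
      have "A \<inter> cball 0 \<rho> \<noteq> {}" if "A \<in> \<A>" "\<rho> > d" for A \<rho>
        using infdist_less_imp[of 0 A \<rho>] d[OF that(1)] that nonempty by fastforce
      then show "{} \<notin> \<G>"
        by (auto simp: \<G>_def)
      show "\<exists>D\<in>\<G>. D \<subseteq> B \<inter> B'" if B: "B \<in> \<G>" "B' \<in> \<G>" for B B'
      proof -
        obtain A A' \<rho> \<rho>' where eq: "B = A \<inter> cball 0 \<rho>" "B' = A' \<inter> cball 0 \<rho>'"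
          and *: "A \<in> \<A>" "A' \<in> \<A>" "\<rho> > d" "\<rho>' > d"
          using B by (auto simp: \<G>_def)
        obtain D where "D \<in> \<A>" "D \<subseteq> A \<inter> A'"
          using directed * by blast
        then have "D \<inter> cball 0 (min \<rho> \<rho>') \<in> \<G>" "D \<inter> cball 0 (min \<rho> \<rho>') \<subseteq> B \<inter> B'"
          using * by (auto simp: \<G>_def eq intro!: exI[of _ "min \<rho> \<rho>'"])
        then show ?thesis
          by blast
      qed
      show "\<exists>B\<in>\<G>. finite_net \<epsilon> B" if "\<epsilon> > 0" for \<epsilon>
      proof -
        from that \<open>d > 0\<close> have "\<epsilon> / (2 * d) > 0"
          by simp
        then obtain c where c: "0 < c" "c < 1" and
          near: "\<And>(p::'a) \<rho> A. \<lbrakk>\<rho> > 0; convex A; A \<noteq> {}; A \<subseteq> cball p \<rho>;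
              \<not> finite_net (\<epsilon> / (2 * d) * \<rho>) A\<rbrakk> \<Longrightarrow> \<exists>a\<in>A. dist p a < (1 - c) * \<rho>"
          using nuc_convex_subset_near_center[OF nuc] by metis
        \<comment> \<open>The radius \<open>(1 + c) * d\<close> exceeds \<open>d\<close>, but shrinking it by the factor \<open>1 - c\<close> leads
          below \<open>d\<close>.\<close>
        define \<rho> where "\<rho> = (1 + c) * d"
        have "c * d > 0" "c * d < d"
          using c \<open>d > 0\<close> by simp_all
        then have \<rho>: "\<rho> > d" "\<rho> > 0" "\<rho> \<le> 2 * d"
          using \<open>d > 0\<close> unfolding \<rho>_def by (simp_all add: distrib_right)
        have "(1 - c) * \<rho> = d - c * c * d"
          by (simp add: \<rho>_def algebra_simps)
        then have "(1 - c) * \<rho> < d"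
          using c \<open>d > 0\<close> by simp
        then obtain A where A: "A \<in> \<A>" "(1 - c) * \<rho> < infdist 0 A"
          unfolding d_def using bdd \<open>\<A> \<noteq> {}\<close> by (subst (asm) less_cSUP_iff) auto
        have B: "A \<inter> cball 0 \<rho> \<in> \<G>"
          using A(1) \<rho>(1) by (auto simp: \<G>_def)
        have "finite_net (\<epsilon> / (2 * d) * \<rho>) (A \<inter> cball 0 \<rho>)"
        proof (rule ccontr)
          assume "\<not> ?thesis"
          moreover have "convex (A \<inter> cball 0 \<rho>)"
            using sets[OF A(1)] by (simp add: convex_Int)
          ultimately obtain a where "a \<in> A" "dist 0 a < (1 - c) * \<rho>"
            using near[of \<rho> "A \<inter> cball 0 \<rho>" 0] \<rho>(2) B \<open>{} \<notin> \<G>\<close> by fastforce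
          then show False
            using A(2) infdist_le[of a A 0] by simp
        qed
        moreover have "\<epsilon> / (2 * d) * \<rho> \<le> \<epsilon>"
          using \<rho>(3) that \<open>d > 0\<close> by (simp add: divide_simps)
        ultimately show ?thesis
          using finite_net_mono[OF _ subset_refl] B by blast
      qed
    qed
    then obtain z where z: "\<And>B. B \<in> \<G> \<Longrightarrow> z \<in> B"
      by blast
    have "z \<in> A" if "A \<in> \<A>" for A
    proof -
      have "A \<inter> cball 0 (d + 1) \<in> \<G>"
        unfolding \<G>_def using that less_add_one[of d] by blast
      then show ?thesis
        using z by blast
    qed
    then show ?thesis
      by blast
  qed
qed

section \<open>Separation of points from closed convex sets\<close>

definition sublinear :: "('a::real_vector \<Rightarrow> real) \<Rightarrow> bool" where
  "sublinear p \<longleftrightarrow> (\<forall>x y. p (x + y) \<le> p x + p y) \<and> (\<forall>t>0. \<forall>x. p (t *\<^sub>R x) = t * p x)"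

lemma sublinear_add: "sublinear p \<Longrightarrow> p (x + y) \<le> p x + p y"
  and sublinear_scale: "sublinear p \<Longrightarrow> t > 0 \<Longrightarrow> p (t *\<^sub>R x) = t * p x"
  by (auto simp: sublinear_def)

lemma sublinear_0: "sublinear p \<Longrightarrow> p 0 = 0"
  using sublinear_scale[of p 2 0] by simp

lemma sublinear_minus: "sublinear p \<Longrightarrow> 0 \<le> p x + p (- x)"
  using sublinear_add[of p x "-x"] sublinear_0[of p] by simp

lemma sublinearI:
  assumes add: "\<And>x y. p (x + y) \<le> p x + p y"
    and scale: "\<And>t x. t > 0 \<Longrightarrow> p (t *\<^sub>R x) \<le> t * p x"
  shows "sublinear p"
proof -
  have "t * p x \<le> p (t *\<^sub>R x)" if "t > 0" for t x
    using scale[of "1/t" "t *\<^sub>R x"] that by (simp add: field_simps)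
  then show ?thesis
    using assms by (auto simp: sublinear_def intro: order_antisym)
qed

lemma le_cINF_add:
  fixes f g :: "'b \<Rightarrow> real"
  assumes "A \<noteq> {}" "\<And>a b. a \<in> A \<Longrightarrow> b \<in> A \<Longrightarrow> s \<le> f a + g b"
  shows "s \<le> (INF a\<in>A. f a) + (INF b\<in>A. g b)"
proof -
  have "s - g b \<le> (INF a\<in>A. f a)" if "b \<in> A" for b
    using assms that by (intro cINF_greatest) (auto simp: algebra_simps)
  then have "s - (INF a\<in>A. f a) \<le> (INF b\<in>A. g b)"
    using assms(1) by (intro cINF_greatest) (auto simp: algebra_simps)
  then show ?thesis
    by simp
qed

lemma cINF_scale_le:
  fixes f g :: "'b \<Rightarrow> real"
  assumes "A \<noteq> {}" "t > 0" "bdd_below (f ` A)" "\<And>a. a \<in> A \<Longrightarrow> \<exists>b\<in>A. f b \<le> t * g a"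
  shows "(INF a\<in>A. f a) \<le> t * (INF a\<in>A. g a)"
proof -
  have "(INF a\<in>A. f a) / t \<le> (INF a\<in>A. g a)"
  proof (rule cINF_greatest[OF assms(1)])
    fix a assume "a \<in> A"
    then obtain b where "b \<in> A" "f b \<le> t * g a"
      using assms(4) by blast
    then have "(INF a\<in>A. f a) \<le> t * g a"
      using cINF_lower[OF assms(3)] order_trans by blast
    then show "(INF a\<in>A. f a) / t \<le> g a"
      using assms(2) by (simp add: divide_simps mult.commute)
  qed
  then show ?thesis
    using assms(2) by (simp add: divide_simps mult.commute)
qed

definition convex_cone :: "('a::real_vector \<times> real) set \<Rightarrow> bool" where
  "convex_cone W \<longleftrightarrow> 0 \<in> W \<and> (\<forall>v\<in>W. \<forall>w\<in>W. v + w \<in> W) \<and> (\<forall>t>0. \<forall>v\<in>W. t *\<^sub>R v \<in> W)"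

text \<open>A pair \<open>(v, s)\<close> of \<open>W\<close> stands for the constraint \<open>s \<le> f v\<close>, which every linear functional
  \<open>f \<le> q\<close> satisfies. The infimum of \<open>p (x + v) - s\<close> over \<open>W\<close> is such a \<open>q\<close>.\<close>

lemma sublinear_below_with_constraints:
  assumes p: "sublinear p" and W: "convex_cone W" and dom: "\<And>v s. (v, s) \<in> W \<Longrightarrow> s \<le> p v"
  obtains q where "sublinear q" "\<And>x. q x \<le> p x" "\<And>v s. (v, s) \<in> W \<Longrightarrow> q (- v) \<le> - s"
proof -
  define g where "g = (\<lambda>x w. p (x + fst w) - snd w)"
  define q where "q = (\<lambda>x. INF w\<in>W. g x w)"
  have W0: "0 \<in> W" and Wadd: "\<And>v w. v \<in> W \<Longrightarrow> w \<in> W \<Longrightarrow> v + w \<in> W"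
    and Wscale: "\<And>t v. t > 0 \<Longrightarrow> v \<in> W \<Longrightarrow> t *\<^sub>R v \<in> W"
    using W by (auto simp: convex_cone_def)
  have "- p (- x) \<le> g x w" if "w \<in> W" for x w
    using sublinear_add[OF p, of "x + fst w" "- x"] dom[of "fst w" "snd w"] that
    by (simp add: g_def)
  then have bdd: "bdd_below (g x ` W)" for x
    by (intro bdd_belowI2[where m = "- p (- x)"])
  have q_le: "q x \<le> g x w" if "w \<in> W" for x w
    unfolding q_def using bdd that by (rule cINF_lower)
  show thesis
  proof (rule that)
    show "sublinear q"
    proof (rule sublinearI)
      fix x y
      have "q (x + y) \<le> g x v + g y w" if "v \<in> W" "w \<in> W" for v w
      proof -
        have "g (x + y) (v + w) \<le> g x v + g y w"
          using sublinear_add[OF p, of "x + fst v" "y + fst w"] by (simp add: g_def algebra_simps)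
        then show ?thesis
          using q_le[OF Wadd[OF that], of "x + y"] by simp
      qed
      then show "q (x + y) \<le> q x + q y"
        using le_cINF_add[of W "q (x + y)" "g x" "g y"] W0 unfolding q_def by blast
    next
      fix t :: real and x assume t: "t > 0"
      have "g (t *\<^sub>R x) (t *\<^sub>R w) = t * g x w" for w
        using sublinear_scale[OF p t, of "x + fst w"] by (simp add: g_def algebra_simps)
      then have "\<exists>v\<in>W. g (t *\<^sub>R x) v \<le> t * g x w" if "w \<in> W" for w
        using Wscale[OF t that] by (metis order_refl)
      then show "q (t *\<^sub>R x) \<le> t * q x"
        unfolding q_def using W0 t bdd by (intro cINF_scale_le) auto
    qed
    show "q x \<le> p x" for x
      using q_le[OF W0, of x] by (simp add: g_def)
    show "q (- v) \<le> - s" if "(v, s) \<in> W" for v s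
      using q_le[OF that, of "- v"] by (simp add: g_def sublinear_0[OF p])
  qed
qed

lemma minimal_sublinear_exists:
  fixes q :: "'a::real_vector \<Rightarrow> real"
  assumes q: "sublinear q"
  obtains f where "sublinear f" "\<And>x. f x \<le> q x"
    "\<And>g. sublinear g \<Longrightarrow> (\<And>x. g x \<le> f x) \<Longrightarrow> g = f"
proof -
  define A where "A = {g. sublinear g \<and> g \<le> q}"
  define P where "P = (\<lambda>g g' :: 'a \<Rightarrow> real. g' \<le> g)"
  have "\<exists>u\<in>A. \<forall>g\<in>\<C>. P g u" if C: "\<C> \<in> Chains (relation_of P A)" for \<C>
  proof (cases "\<C> = {}")
    case True
    then show ?thesis using q by (auto simp: A_def)
  next
    case False
    have CA: "g \<in> A" if "g \<in> \<C>" for g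
      using C that by (auto simp: Chains_def relation_of_def)
    have lin: "g \<le> g' \<or> g' \<le> g" if "g \<in> \<C>" "g' \<in> \<C>" for g g'
      using C that by (auto simp: Chains_def relation_of_def P_def)
    define u where "u = (\<lambda>x. INF g\<in>\<C>. g x)"
    \<comment> \<open>The values \<open>- q (- x)\<close> bound all members of the chain from below, so that their pointwise
      infimum exists.\<close>
    have "- q (- x) \<le> g x" if "g \<in> \<C>" for g x
      using CA[OF that] sublinear_minus[of g x] le_funD[of g q "-x"] by (auto simp: A_def)
    then have bdd: "bdd_below ((\<lambda>g. g x) ` \<C>)" for x
      by (auto simp: bdd_below_def)
    have u_le: "u x \<le> g x" if "g \<in> \<C>" for g x
      unfolding u_def using bdd that by (rule cINF_lower)
    have "sublinear u"
    proof (rule sublinearI)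
      fix x y
      have "u (x + y) \<le> g x + g' y" if gg: "g \<in> \<C>" "g' \<in> \<C>" for g g'
      proof -
        obtain h where h: "h \<in> \<C>" "h \<le> g" "h \<le> g'"
          using lin[OF gg] gg by blast
        have "u (x + y) \<le> h x + h y"
          using u_le[OF h(1), of "x + y"] sublinear_add[of h x y] CA[OF h(1)]
          by (simp add: A_def)
        then show ?thesis
          using le_funD[OF h(2), of x] le_funD[OF h(3), of y] by simp
      qed
      then show "u (x + y) \<le> u x + u y"
        using le_cINF_add[OF False, of "u (x + y)" "\<lambda>g. g x" "\<lambda>g. g y"] unfolding u_def by blast
    next
      fix t :: real and x assume t: "t > 0"
      have "\<exists>h\<in>\<C>. h (t *\<^sub>R x) \<le> t * g x" if "g \<in> \<C>" for g
        using CA[OF that] t that by (auto simp: A_def sublinear_scale intro!: bexI[of _ g])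
      then show "u (t *\<^sub>R x) \<le> t * u x"
        unfolding u_def using False t bdd by (intro cINF_scale_le) auto
    qed
    moreover have "u \<le> q"
      using False CA u_le order_trans by (fastforce simp: A_def le_fun_def)
    ultimately show ?thesis
      using u_le by (auto simp: A_def P_def le_fun_def)
  qed
  moreover have "partial_order_on A (relation_of P A)"
    by (auto simp: partial_order_on_def preorder_on_def refl_on_def trans_def antisym_def
        relation_of_def P_def)
  ultimately obtain f where f: "f \<in> A" and min: "\<And>g. g \<in> A \<Longrightarrow> g \<le> f \<Longrightarrow> g = f"
    using predicate_Zorn[of A P] by (auto simp: P_def)
  show thesis
  proof (rule that)
    show "sublinear f" "f x \<le> q x" for x
      using f by (auto simp: A_def le_fun_def)
    show "g = f" if "sublinear g" "\<And>x. g x \<le> f x" for g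
    proof (rule min)
      show "g \<le> f" using that(2) by (simp add: le_fun_def)
      then show "g \<in> A" using that(1) f by (auto simp: A_def)
    qed
  qed
qed

text \<open>If \<open>f\<close> is minimal, then adding to it the constraint that a functional be at least \<open>f y\<close> at
  the point \<open>y\<close> does not change it; hence \<open>f (- y) = - f y\<close>.\<close>

lemma minimal_sublinear_linear:
  assumes f: "sublinear f" and min: "\<And>g. sublinear g \<Longrightarrow> (\<And>x. g x \<le> f x) \<Longrightarrow> g = f"
  shows "linear f"
proof -
  have minus: "f (- y) = - f y" for y
  proof -
    define W where "W = {(t *\<^sub>R y, t * f y) | t. t \<ge> 0}"
    have "convex_cone W"
      unfolding convex_cone_def
    proof (intro conjI ballI allI impI)
      show "0 \<in> W"
        by (auto simp: W_def zero_prod_def intro!: exI[of _ 0])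
    next
      fix v w assume "v \<in> W" "w \<in> W"
      then obtain a b where "v = (a *\<^sub>R y, a * f y)" "w = (b *\<^sub>R y, b * f y)" "a \<ge> 0" "b \<ge> 0"
        by (auto simp: W_def)
      then show "v + w \<in> W"
        by (auto simp: W_def algebra_simps intro!: exI[of _ "a + b"])
    next
      fix t :: real and v assume "t > 0" "v \<in> W"
      then obtain a where "v = (a *\<^sub>R y, a * f y)" "a \<ge> 0"
        by (auto simp: W_def)
      with \<open>t > 0\<close> show "t *\<^sub>R v \<in> W"
        by (auto simp: W_def intro!: exI[of _ "t * a"])
    qed
    moreover have "s \<le> f v" if "(v, s) \<in> W" for v s
    proof -
      obtain t where t: "t \<ge> 0" "v = t *\<^sub>R y" "s = t * f y"
        using \<open>(v, s) \<in> W\<close> by (auto simp: W_def)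
      then show ?thesis
        using sublinear_scale[OF f, of t y] sublinear_0[OF f] by (cases "t = 0") auto
    qed
    ultimately obtain g where g: "sublinear g" "\<And>x. g x \<le> f x" "\<And>v s. (v, s) \<in> W \<Longrightarrow> g (- v) \<le> - s"
      using sublinear_below_with_constraints[OF f] by metis
    have "(y, f y) \<in> W"
      by (auto simp: W_def intro!: exI[of _ 1])
    then have "f (- y) \<le> - f y"
      using g(3) min[OF g(1,2)] by blast
    then show ?thesis
      using sublinear_minus[OF f, of y] by simp
  qed
  have add: "f (x + y) = f x + f y" for x y
    using sublinear_add[OF f, of x y] sublinear_add[OF f, of "x + y" "- y"] minus[of y] by simp
  have scale: "f (t *\<^sub>R x) = t * f x" for t x
  proof -
    consider "t > 0" | "t = 0" | "- t > 0"
      by linarith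
    then show ?thesis
    proof cases
      case 3
      then show ?thesis
        using sublinear_scale[OF f 3, of x] minus[of "t *\<^sub>R x"] by simp
    qed (auto simp: sublinear_scale[OF f] sublinear_0[OF f])
  qed
  show ?thesis
    by (rule linearI) (auto simp: add scale)
qed

text \<open>The constraints \<open>t * d \<le> f (t *\<^sub>R (a - z))\<close> for \<open>a \<in> A\<close>, with \<open>d\<close> the distance from \<open>z\<close> to
  \<open>A\<close>, are compatible with \<open>f \<le> norm\<close>.\<close>

lemma separate_point_closed_convex:
  fixes A :: "'a::real_normed_vector set"
  assumes "closed A" "convex A" "A \<noteq> {}" "z \<notin> A"
  obtains f :: "'a \<Rightarrow> real" and b where "bounded_linear f" "f z < b" "\<And>a. a \<in> A \<Longrightarrow> b \<le> f a"
proof -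
  define d where "d = infdist z A"
  have d: "d > 0"
    using assms infdist_pos_not_in_closed d_def by metis
  define W where "W = {(t *\<^sub>R (a - z), t * d) | t a. t \<ge> 0 \<and> a \<in> A}"
  have WI: "(t *\<^sub>R (a - z), t * d) \<in> W" if "t \<ge> 0" "a \<in> A" for t a
    using that by (auto simp: W_def)
  have "convex_cone W"
    unfolding convex_cone_def
  proof (intro conjI ballI allI impI)
    show "0 \<in> W"
      using assms(3) WI[of 0] by (auto simp: zero_prod_def)
  next
    fix v w assume "v \<in> W" "w \<in> W"
    then obtain s a t b where v: "v = (s *\<^sub>R (a - z), s * d)" "s \<ge> 0" "a \<in> A"
      and w: "w = (t *\<^sub>R (b - z), t * d)" "t \<ge> 0" "b \<in> A"
      by (auto simp: W_def)
    show "v + w \<in> W"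
    proof (cases "s + t = 0")
      case True
      then have "s = 0" "t = 0"
        using v(2) w(2) by auto
      then show ?thesis
        using WI[of 0 a] v w by simp
    next
      case False
      then have pos: "s + t > 0"
        using v(2) w(2) by simp
      define e where "e = (s / (s + t)) *\<^sub>R a + (t / (s + t)) *\<^sub>R b"
      have "e \<in> A"
        unfolding e_def using assms(2) v w pos by (intro convexD)
          (auto simp: add_divide_distrib[symmetric])
      moreover have "(s + t) *\<^sub>R e = s *\<^sub>R a + t *\<^sub>R b"
        using pos by (simp add: e_def scaleR_right_distrib)
      then have "v + w = ((s + t) *\<^sub>R (e - z), (s + t) * d)"
        by (simp add: v(1) w(1) algebra_simps)
      ultimately show ?thesis
        using WI[of "s + t" e] pos by simp
    qed
  next
    fix t :: real and v assume "t > 0" "v \<in> W"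
    then obtain s a where "v = (s *\<^sub>R (a - z), s * d)" "s \<ge> 0" "a \<in> A"
      by (auto simp: W_def)
    then show "t *\<^sub>R v \<in> W"
      using WI[of "t * s" a] \<open>t > 0\<close> by (simp add: mult.assoc)
  qed
  moreover have norm: "sublinear (norm :: 'a \<Rightarrow> real)"
    by (rule sublinearI) (auto simp: norm_triangle_ineq)
  moreover have "s \<le> norm v" if vs: "(v, s) \<in> W" for v s
  proof -
    obtain t a where t: "t \<ge> 0" "a \<in> A" "v = t *\<^sub>R (a - z)" "s = t * d"
      using vs by (auto simp: W_def)
    have "d \<le> norm (a - z)"
      using infdist_le[OF t(2), of z] by (simp add: d_def dist_norm norm_minus_commute)
    then show ?thesis
      using t by (simp add: mult_left_mono)
  qed
  ultimately obtain q where q: "sublinear q" "\<And>x::'a. q x \<le> norm x"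
    "\<And>v s. (v, s) \<in> W \<Longrightarrow> q (- v) \<le> - s"
    using sublinear_below_with_constraints[of norm W] by metis
  obtain f where f: "sublinear f" "\<And>x. f x \<le> q x"
    "\<And>g. sublinear g \<Longrightarrow> (\<And>x. g x \<le> f x) \<Longrightarrow> g = f"
    using minimal_sublinear_exists[OF q(1)] by metis
  have lin: "linear f"
    using f(1,3) by (rule minimal_sublinear_linear)
  have le: "f x \<le> norm x" for x
    using f(2)[of x] q(2)[of x] by simp
  show thesis
  proof (rule that)
    have "\<bar>f x\<bar> \<le> norm x" for x
      using le[of x] le[of "- x"] linear_neg[OF lin, of x] by simp
    then show "bounded_linear f"
      using lin by (intro bounded_linear_intro[where K = 1]) (auto simp: linear_add linear_scale)
    show "f z < f z + d"
      using d by simp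
    show "f z + d \<le> f a" if "a \<in> A" for a
    proof -
      have "f (- (a - z)) \<le> - d"
        using q(3)[of "a - z" d] WI[of 1 a] that f(2)[of "- (a - z)"] by simp
      then show ?thesis
        using linear_diff[OF lin, of z a] by simp
    qed
  qed
qed

section \<open>Weak limits along ultrafilters and weak cluster points\<close>

lemma weak_tendsto_imp_eventually:
  fixes y :: "'i \<Rightarrow> 'b::real_normed_vector"
  assumes weak: "\<And>f. bounded_linear f \<Longrightarrow> ((\<lambda>i. f (y i)) \<longlongrightarrow> (f w :: real)) F"
    and "openin weak_topology V" "w \<in> V"
  shows "eventually (\<lambda>i. y i \<in> V) F"
proof -
  have "generate_topology_on {f -` U | (f :: 'b \<Rightarrow> real) U. bounded_linear f \<and> open U} V"
    using assms(2) unfolding weak_topology_def openin_topology_generated_by_iff .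
  then have "w \<in> V \<longrightarrow> eventually (\<lambda>i. y i \<in> V) F"
  proof induction
    case (Int a b)
    then show ?case by (auto intro: eventually_conj)
  next
    case (UN K)
    show ?case
    proof
      assume "w \<in> \<Union>K"
      then obtain k where "k \<in> K" "eventually (\<lambda>i. y i \<in> k) F"
        using UN.IH by blast
      then show "eventually (\<lambda>i. y i \<in> \<Union>K) F"
        by (auto elim: eventually_mono)
    qed
  next
    case (Basis S)
    then obtain f :: "'b \<Rightarrow> real" and U where "S = f -` U" "bounded_linear f" "open U"
      by blast
    then show ?case
      using topological_tendstoD[OF weak] by auto
  qed auto
  then show ?thesis
    using assms(3) by blast
qed

lemma openin_weak_halfspace:
  fixes f :: "'a::real_normed_vector \<Rightarrow> real"
  assumes "bounded_linear f"
  shows "openin weak_topology {x. f x < b}"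
proof -
  have "f -` {..<b} \<in> {f -` U | (f :: 'a \<Rightarrow> real) U. bounded_linear f \<and> open U}"
    using assms by (intro CollectI exI[of _ f] exI[of _ "{..<b}"]) simp
  moreover have "{x. f x < b} = f -` {..<b}"
    by auto
  ultimately show ?thesis
    unfolding weak_topology_def by (simp only: topology_generated_by_Basis)
qed

lemma weak_tendsto_imp_cluster_point:
  assumes weak: "\<And>f. bounded_linear f \<Longrightarrow> ((\<lambda>k. f (s (\<sigma> k))) \<longlongrightarrow> (f w :: real)) U"
    and U: "U \<noteq> bot" "U \<le> sequentially" and \<sigma>: "filterlim \<sigma> sequentially sequentially"
  shows "w \<in> cluster_points weak_topology s"
  unfolding cluster_points_def
proof (intro CollectI conjI allI impI)
  have "w \<in> {x. (\<lambda>_. 0) x < (1::real)}"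
    by simp
  then show "w \<in> topspace weak_topology"
    using openin_subset[OF openin_weak_halfspace[OF bounded_linear_zero, of 1]] by blast
  fix V assume "openin weak_topology V \<and> w \<in> V"
  then have "eventually (\<lambda>k. s (\<sigma> k) \<in> V) U"
    using weak_tendsto_imp_eventually[of "\<lambda>k. s (\<sigma> k)", OF weak] by blast
  show "\<exists>\<^sub>F n in sequentially. s n \<in> V"
    unfolding frequently_def
  proof
    assume "eventually (\<lambda>n. s n \<notin> V) sequentially"
    then have "eventually (\<lambda>k. s (\<sigma> k) \<notin> V) U"
      using eventually_compose_filterlim[OF _ \<sigma>] filter_leD[OF U(2)] by blast
    with \<open>eventually (\<lambda>k. s (\<sigma> k) \<in> V) U\<close> have "eventually (\<lambda>k. False) U"
      by eventually_elim simp
    then show False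
      using U(1) by (simp add: trivial_limit_def)
  qed
qed

lemma weak_cluster_point_in_closed_convex:
  assumes w: "w \<in> cluster_points weak_topology s"
    and A: "closed A" "convex A" and ev: "eventually (\<lambda>n. s n \<in> A) sequentially"
  shows "w \<in> A"
proof (rule ccontr)
  assume "w \<notin> A"
  moreover have "A \<noteq> {}"
    using eventually_happens[OF ev] by auto
  ultimately obtain f :: "'a \<Rightarrow> real" and b
    where f: "bounded_linear f" "f w < b" "\<And>a. a \<in> A \<Longrightarrow> b \<le> f a"
    using separate_point_closed_convex A by metis
  then have "\<exists>\<^sub>F n in sequentially. s n \<in> {x. f x < b}"
    using w openin_weak_halfspace[OF f(1), of b] unfolding cluster_points_def by blast
  moreover have "eventually (\<lambda>n. s n \<notin> {x. f x < b}) sequentially"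
    using ev by eventually_elim (use f(3) in force)
  ultimately show False
    by (simp add: frequently_def)
qed

text \<open>An ultrafilter version of the fact that, in a reflexive space, the closed convex hulls of the
  tails of a weakly convergent sequence have just the limit in common. The second conclusion is
  stronger than weak convergence: a closed ball contains \<open>w\<close> as soon as it meets each hull,
  at a point that may depend on the hull.\<close>

lemma nuc_ultrafilter_weak_limit:
  fixes y :: "'i \<Rightarrow> 'a::banach"
  assumes nuc: "nearly_uniformly_convex TYPE('a)" and U: "ultrafilter U"
    and bdd: "bounded (range y)"
  obtains w where "\<And>f. bounded_linear f \<Longrightarrow> ((\<lambda>i. f (y i)) \<longlongrightarrow> (f w :: real)) U"
    "\<And>p \<rho>. (\<And>S. eventually (\<lambda>i. i \<in> S) U \<Longrightarrow> \<exists>a\<in>convex hull (y ` S). dist p a \<le> \<rho>) \<Longrightarrow> dist p w \<le> \<rho>"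
proof -
  define H where "H = (\<lambda>S. closure (convex hull (y ` S)))"
  define core where "core = (\<Inter>S\<in>{S. eventually (\<lambda>i. i \<in> S) U}. H S)"
  have H_mono: "H S \<subseteq> H S'" if "S \<subseteq> S'" for S S'
    unfolding H_def using that by (intro closure_mono hull_mono) auto
  have subset_H: "y ` S \<subseteq> H S" for S
    unfolding H_def using hull_subset closure_subset by (metis order_trans)
  have U_bot: "U \<noteq> bot"
    using U by (simp add: ultrafilter_def)
  have below: "eventually (\<lambda>i. g (y i) < g z + e) U"
    if z: "z \<in> core" and g: "bounded_linear g" and e: "e > 0" for z e and g :: "'a \<Rightarrow> real"
  proof (rule ccontr)
    let ?S = "{i. \<not> g (y i) < g z + e}" and ?A = "{x. g z + e \<le> g x}"
    assume "\<not> ?thesis"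
    then have "eventually (\<lambda>i. i \<in> ?S) U"
      using U unfolding ultrafilter_def by auto
    then have "z \<in> H ?S"
      using z by (auto simp: core_def)
    have lin: "linear g"
      using g by (rule bounded_linear.linear)
    have "closed ?A"
      using g by (intro closed_Collect_le continuous_on_const linear_continuous_on)
    moreover have "convex ?A"
    proof -
      have "?A = g -` {g z + e..}"
        by auto
      then show ?thesis
        using convex_linear_vimage[OF lin, of "{g z + e..}"] by simp
    qed
    moreover have "y ` ?S \<subseteq> ?A"
      by auto
    ultimately have "H ?S \<subseteq> ?A"
      unfolding H_def by (intro closure_minimal hull_minimal)
    then show False
      using \<open>z \<in> H ?S\<close> e by auto
  qed
  have lim: "((\<lambda>i. f (y i)) \<longlongrightarrow> f z) U" if z: "z \<in> core" and f: "bounded_linear f" for z and f :: "'a \<Rightarrow> real"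
  proof (rule tendstoI)
    fix e :: real assume "e > 0"
    from below[OF z f this] below[OF z bounded_linear_minus[OF f] this]
    show "eventually (\<lambda>i. dist (f (y i)) (f z) < e) U"
      by eventually_elim (auto simp: dist_real_def)
  qed
  have unique: "z = z'" if "z \<in> core" "z' \<in> core" for z z'
  proof (rule ccontr)
    assume "z \<noteq> z'"
    then obtain f :: "'a \<Rightarrow> real" and b where f: "bounded_linear f" "f z < b" "b \<le> f z'"
      using separate_point_closed_convex[of "{z'}" z] by auto
    have "f z = f z'"
      by (rule tendsto_unique[OF U_bot lim[OF that(1) f(1)] lim[OF that(2) f(1)]])
    then show False
      using f by simp
  qed
  have meet: "core \<inter> B \<noteq> {}"
    if B: "closed B" "convex B" and ne: "\<And>S. eventually (\<lambda>i. i \<in> S) U \<Longrightarrow> H S \<inter> B \<noteq> {}" for B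
  proof -
    define \<A> where "\<A> = {H S \<inter> B | S. eventually (\<lambda>i. i \<in> S) U}"
    have "\<Inter>\<A> \<noteq> {}"
    proof (rule nuc_directed_intersection[OF nuc, of _ "H UNIV"])
      show "\<A> \<noteq> {}"
        by (auto simp: \<A>_def intro!: exI[of _ UNIV])
      show "{} \<notin> \<A>"
        using ne by (auto simp: \<A>_def)
      show "closed A \<and> convex A \<and> A \<subseteq> H UNIV" if "A \<in> \<A>" for A
        using that B H_mono[of _ UNIV]
        by (auto simp: \<A>_def H_def intro: convex_Int convex_closure)
      show "bounded (H UNIV)"
        unfolding H_def using bdd by (intro bounded_closure bounded_convex_hull)
      fix A A' assume "A \<in> \<A>" "A' \<in> \<A>"
      then obtain S S' where S: "A = H S \<inter> B" "A' = H S' \<inter> B"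
        "eventually (\<lambda>i. i \<in> S) U" "eventually (\<lambda>i. i \<in> S') U"
        by (auto simp: \<A>_def)
      have "eventually (\<lambda>i. i \<in> S \<inter> S') U"
        using S(3,4) by (simp add: eventually_conj_iff)
      then have "H (S \<inter> S') \<inter> B \<in> \<A>"
        unfolding \<A>_def by blast
      moreover have "H (S \<inter> S') \<inter> B \<subseteq> A \<inter> A'"
        using H_mono[of "S \<inter> S'" S] H_mono[of "S \<inter> S'" S'] S(1,2) by blast
      ultimately show "\<exists>D\<in>\<A>. D \<subseteq> A \<inter> A'"
        by blast
    qed
    then obtain z where z: "\<And>A. A \<in> \<A> \<Longrightarrow> z \<in> A"
      by blast
    have "z \<in> H S \<inter> B" if "eventually (\<lambda>i. i \<in> S) U" for S
      using that by (intro z) (auto simp: \<A>_def)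
    from this this[of UNIV] show ?thesis
      by (auto simp: core_def)
  qed
  have "H S \<noteq> {}" if "eventually (\<lambda>i. i \<in> S) U" for S
  proof -
    have "S \<noteq> {}"
      using that U_bot by (auto simp: trivial_limit_def)
    then show ?thesis
      using subset_H[of S] by auto
  qed
  then obtain w where w: "w \<in> core"
    using meet[of UNIV] by auto
  show thesis
  proof (rule that)
    show "((\<lambda>i. f (y i)) \<longlongrightarrow> f w) U" if "bounded_linear f" for f :: "'a \<Rightarrow> real"
      using lim[OF w that] .
    fix p \<rho> assume near: "\<And>S. eventually (\<lambda>i. i \<in> S) U \<Longrightarrow> \<exists>a\<in>convex hull (y ` S). dist p a \<le> \<rho>"
    have "H S \<inter> cball p \<rho> \<noteq> {}" if "eventually (\<lambda>i. i \<in> S) U" for S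
      using near[OF that] closure_subset[of "convex hull (y ` S)"] by (auto simp: H_def)
    then obtain z where "z \<in> core" "z \<in> cball p \<rho>"
      using meet[of "cball p \<rho>"] by auto
    then show "dist p w \<le> \<rho>"
      using unique[OF w] by auto
  qed
qed

section \<open>Asymptotic radii\<close>

text \<open>The limit superior of \<open>norm (s n - z)\<close>, for a bounded sequence \<open>s\<close>.\<close>

definition asymptotic_radius :: "(nat \<Rightarrow> 'a::real_normed_vector) \<Rightarrow> 'a \<Rightarrow> real" where
  "asymptotic_radius s z = Inf {t. eventually (\<lambda>n. norm (s n - z) \<le> t) sequentially}"

lemma eventually_norm_le_imp_nonneg:
  assumes "eventually (\<lambda>n. norm (s n - z) \<le> t) sequentially"
  shows "0 \<le> t"
proof -
  obtain n where "norm (s n - z) \<le> t"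
    using eventually_happens[OF assms] by auto
  then show ?thesis
    using norm_ge_zero order_trans by blast
qed

lemma asymptotic_radius_le_iff:
  assumes "bounded (range s)"
  shows "asymptotic_radius s z \<le> r \<longleftrightarrow>
    (\<forall>t>r. eventually (\<lambda>n. norm (s n - z) \<le> t) sequentially)"
proof -
  define E where "E = {t. eventually (\<lambda>n. norm (s n - z) \<le> t) sequentially}"
  obtain M where M: "\<And>n. norm (s n) \<le> M"
    using assms by (auto simp: bounded_iff)
  have "norm (s n - z) \<le> M + norm z" for n
    using norm_triangle_ineq4[of "s n" z] M[of n] by simp
  then have ne: "E \<noteq> {}"
    by (auto simp: E_def intro!: exI[of _ "M + norm z"])
  have bdd: "bdd_below E"
    using eventually_norm_le_imp_nonneg[of s z] by (auto simp: E_def intro!: bdd_belowI[of _ 0])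
  show ?thesis
  proof
    assume "asymptotic_radius s z \<le> r"
    show "\<forall>t>r. eventually (\<lambda>n. norm (s n - z) \<le> t) sequentially"
    proof (intro allI impI)
      fix t assume "t > r"
      with \<open>asymptotic_radius s z \<le> r\<close> have "Inf E < t"
        by (simp add: asymptotic_radius_def E_def)
      then obtain t' where "t' \<in> E" "t' < t"
        using cInf_lessD[OF ne] by blast
      then show "eventually (\<lambda>n. norm (s n - z) \<le> t) sequentially"
        by (auto simp: E_def elim!: eventually_mono)
    qed
  next
    assume *: "\<forall>t>r. eventually (\<lambda>n. norm (s n - z) \<le> t) sequentially"
    have "Inf E \<le> t" if "t > r" for t
      using cInf_lower[OF _ bdd, of t] * that by (simp add: E_def)
    then show "asymptotic_radius s z \<le> r"
      unfolding asymptotic_radius_def E_def[symmetric] by (rule dense_ge)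
  qed
qed

lemma asymptotic_radius_nonneg:
  assumes "bounded (range s)"
  shows "0 \<le> asymptotic_radius s z"
proof (rule dense_ge)
  fix t assume "asymptotic_radius s z < t"
  then have "eventually (\<lambda>n. norm (s n - z) \<le> t) sequentially"
    using asymptotic_radius_le_iff[OF assms, of z "asymptotic_radius s z"] by simp
  then show "0 \<le> t"
    by (rule eventually_norm_le_imp_nonneg)
qed

lemma convex_asymptotic_radius_sublevel:
  assumes "bounded (range s)"
  shows "convex {z. asymptotic_radius s z \<le> r}"
proof (rule convexI)
  fix x y and u v :: real
  assume xy: "x \<in> {z. asymptotic_radius s z \<le> r}" "y \<in> {z. asymptotic_radius s z \<le> r}"
    and uv: "0 \<le> u" "0 \<le> v" "u + v = 1"
  have "eventually (\<lambda>n. norm (s n - (u *\<^sub>R x + v *\<^sub>R y)) \<le> t) sequentially" if "t > r" for t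
  proof -
    have "eventually (\<lambda>n. norm (s n - x) \<le> t) sequentially"
      "eventually (\<lambda>n. norm (s n - y) \<le> t) sequentially"
      using xy that by (auto simp: asymptotic_radius_le_iff[OF assms])
    then show ?thesis
    proof eventually_elim
      case (elim n)
      then have "u *\<^sub>R x + v *\<^sub>R y \<in> cball (s n) t"
        using uv by (intro convexD[OF convex_cball]) (auto simp: dist_norm)
      then show ?case
        by (simp add: dist_norm)
    qed
  qed
  then show "u *\<^sub>R x + v *\<^sub>R y \<in> {z. asymptotic_radius s z \<le> r}"
    by (simp add: asymptotic_radius_le_iff[OF assms])
qed

lemma closed_asymptotic_radius_sublevel:
  assumes "bounded (range s)"
  shows "closed {z. asymptotic_radius s z \<le> r}"
proof -
  have "asymptotic_radius s z \<le> r" if z: "z \<in> closure {z. asymptotic_radius s z \<le> r}" for z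
    unfolding asymptotic_radius_le_iff[OF assms]
  proof (intro allI impI)
    fix t assume "t > r"
    then obtain y where y: "asymptotic_radius s y \<le> r" "dist y z < (t - r) / 2"
      using z unfolding closure_approachable by (metis diff_gt_0_iff_gt half_gt_zero mem_Collect_eq)
    have "r < r + (t - r) / 2"
      using \<open>t > r\<close> by simp
    then have "eventually (\<lambda>n. norm (s n - y) \<le> r + (t - r) / 2) sequentially"
      using y(1) unfolding asymptotic_radius_le_iff[OF assms] by blast
    then show "eventually (\<lambda>n. norm (s n - z) \<le> t) sequentially"
    proof eventually_elim
      case (elim n)
      have "norm (s n - z) \<le> norm (s n - y) + norm (y - z)"
        using norm_triangle_ineq[of "s n - y" "y - z"] by simp
      then show ?case
        using elim y(2) by (simp add: dist_norm field_simps)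
    qed
  qed
  then show ?thesis
    using closure_subset_eq by blast
qed

section \<open>Sequences that are asymptotically equidistant from a convex set\<close>

text \<open>By the assumption \<open>mutual\<close>, the terms of \<open>s\<close> lie asymptotically no further from each other
  than from the points of \<open>K\<close>. If \<open>s \<circ> \<sigma>\<close> did not converge in norm along \<open>U\<close>, its weak limit
  \<open>w\<close> would be within \<open>(1 - c) * (1 + c) * r\<close> of almost all terms of \<open>s\<close>: apply near uniform
  convexity in balls centred at these terms. But \<open>w\<close> is a point of \<open>K\<close>.\<close>

lemma equidistant_sequence_norm_limit:
  fixes s :: "nat \<Rightarrow> 'a::banach"
  assumes nuc: "nearly_uniformly_convex TYPE('a)" and bdd: "bounded (range s)"
    and radius: "\<And>v. v \<in> K \<Longrightarrow> asymptotic_radius s v = r" and r: "r > 0"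
    and cluster: "cluster_points weak_topology s \<subseteq> K"
    and mutual: "\<And>t. t > r \<Longrightarrow>
      eventually (\<lambda>n. eventually (\<lambda>m. norm (s m - s n) \<le> t) sequentially) sequentially"
    and U: "ultrafilter U" "U \<le> sequentially" and \<sigma>: "filterlim \<sigma> sequentially sequentially"
  obtains w where "w \<in> K" "((\<lambda>k. s (\<sigma> k)) \<longlongrightarrow> w) U"
proof -
  define y where "y = (\<lambda>k. s (\<sigma> k))"
  have U_bot: "U \<noteq> bot"
    using U(1) by (simp add: ultrafilter_def)
  have in_K: "w \<in> K" if "\<And>f. bounded_linear f \<Longrightarrow> ((\<lambda>k. f (y k)) \<longlongrightarrow> (f w :: real)) U" for w
    using weak_tendsto_imp_cluster_point[of s \<sigma> w U] that U_bot U(2) \<sigma> cluster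
    by (auto simp: y_def)
  have along: "eventually (\<lambda>k. P (\<sigma> k)) U" if "eventually P sequentially" for P
    using eventually_compose_filterlim[OF that \<sigma>] U(2) by (rule filter_leD[rotated])
  have y_bdd: "bounded (range y)"
    using bdd by (rule bounded_subset) (auto simp: y_def)
  obtain w where weak: "\<And>f. bounded_linear f \<Longrightarrow> ((\<lambda>k. f (y k)) \<longlongrightarrow> (f w :: real)) U"
    and near_w: "\<And>p \<rho>. (\<And>S. eventually (\<lambda>k. k \<in> S) U \<Longrightarrow> \<exists>a\<in>convex hull (y ` S). dist p a \<le> \<rho>)
      \<Longrightarrow> dist p w \<le> \<rho>"
    using nuc_ultrafilter_weak_limit[OF nuc U(1) y_bdd] by metis
  have small: "\<exists>p. eventually (\<lambda>k. y k \<in> cball p \<epsilon>) U" if \<epsilon>: "\<epsilon> > 0" for \<epsilon>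
  proof (rule ccontr)
    assume none: "\<not> ?thesis"
    have no_net: "\<not> finite_net \<epsilon> (y ` S)" if S: "eventually (\<lambda>k. k \<in> S) U" for S
    proof
      assume "finite_net \<epsilon> (y ` S)"
      then obtain k where k: "finite k" "y ` S \<subseteq> (\<Union>x\<in>k. cball x \<epsilon>)"
        by (auto simp: finite_net_def)
      have "eventually (\<lambda>i. i \<in> (\<Union>x\<in>k. y -` cball x \<epsilon>)) U"
        using S by (rule eventually_mono) (use k(2) in \<open>simp add: image_subset_iff\<close>)
      from ultrafilter_finite_Union[OF U(1) k(1) this] show False
        using none by auto
    qed
    have "\<epsilon> / (2 * r) > 0"
      using \<epsilon> r by simp
    then obtain c where c: "0 < c" "c < 1" and
      near: "\<And>(p::'a) \<rho> A. \<lbrakk>\<rho> > 0; convex A; A \<noteq> {}; A \<subseteq> cball p \<rho>;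
          \<not> finite_net (\<epsilon> / (2 * r) * \<rho>) A\<rbrakk> \<Longrightarrow> \<exists>a\<in>A. dist p a < (1 - c) * \<rho>"
      using nuc_convex_subset_near_center[OF nuc] by metis
    define \<rho> where "\<rho> = (1 + c) * r"
    have "c * r > 0" "c * r < r"
      using c r by simp_all
    then have \<rho>: "\<rho> > r" "\<rho> > 0" "\<rho> \<le> 2 * r"
      using r unfolding \<rho>_def by (simp_all add: distrib_right)
    have net_radius: "\<epsilon> / (2 * r) * \<rho> \<le> \<epsilon>"
      using \<rho>(3) \<epsilon> r by (simp add: divide_simps)
    have "norm (s n - w) \<le> (1 - c) * \<rho>"
      if n: "eventually (\<lambda>m. norm (s m - s n) \<le> \<rho>) sequentially" for n
    proof -
      have "\<exists>a\<in>convex hull (y ` S). dist (s n) a \<le> (1 - c) * \<rho>"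
        if S: "eventually (\<lambda>k. k \<in> S) U" for S
      proof -
        define S' where "S' = {k\<in>S. norm (y k - s n) \<le> \<rho>}"
        have S': "eventually (\<lambda>k. k \<in> S') U"
          using S along[OF n] by (simp add: S'_def y_def eventually_conj_iff)
        then have "S' \<noteq> {}"
          using U_bot by (auto simp: trivial_limit_def)
        have "y ` S' \<subseteq> cball (s n) \<rho>"
          by (auto simp: S'_def dist_norm norm_minus_commute)
        then have sub: "convex hull (y ` S') \<subseteq> cball (s n) \<rho>"
          by (rule hull_minimal) (rule convex_cball)
        have "\<not> finite_net (\<epsilon> / (2 * r) * \<rho>) (convex hull (y ` S'))"
          using no_net[OF S'] finite_net_mono[OF _ hull_subset net_radius] by blast
        then obtain a where "a \<in> convex hull (y ` S')" "dist (s n) a < (1 - c) * \<rho>"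
          using near[OF \<rho>(2) convex_convex_hull _ sub] \<open>S' \<noteq> {}\<close> by auto
        moreover have "convex hull (y ` S') \<subseteq> convex hull (y ` S)"
          by (intro hull_mono image_mono) (auto simp: S'_def)
        ultimately show ?thesis
          using less_imp_le by blast
      qed
      then show ?thesis
        using near_w by (simp add: dist_norm)
    qed
    then have "eventually (\<lambda>n. norm (s n - w) \<le> (1 - c) * \<rho>) sequentially"
      using mutual[OF \<rho>(1)] by (auto elim: eventually_mono)
    then have "asymptotic_radius s w \<le> (1 - c) * \<rho>"
      unfolding asymptotic_radius_le_iff[OF bdd] by (auto elim: eventually_mono)
    moreover have "(1 - c) * \<rho> = r - c * c * r"
      by (simp add: \<rho>_def algebra_simps)
    then have "(1 - c) * \<rho> < r"
      using c r by simp
    ultimately show False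
      using radius[OF in_K[OF weak]] by simp
  qed
  have "\<exists>l. filtermap y U \<le> nhds l"
    by (rule small_balls_imp_convergent)
      (use U_bot small in \<open>auto simp: filtermap_bot_iff eventually_filtermap\<close>)
  then obtain l where l: "(y \<longlongrightarrow> l) U"
    by (auto simp: filterlim_def)
  have "l \<in> K"
    using l by (intro in_K) (rule bounded_linear.tendsto)
  then show thesis
    using that l by (simp add: y_def)
qed

text \<open>The norm cluster points of \<open>s\<close> have mutual distances at most \<open>r\<close>, while every point of \<open>K\<close> is
  at distance exactly \<open>r\<close> from some cluster point. Taking the mean of finitely many cluster points
  yields a further one at distance \<open>r\<close> from all of them; if \<open>r > 0\<close>, the infinite sequence obtained
  in this way contradicts the previous lemma. This is the classical proof that compact convex sets
  have normal structure.\<close>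

lemma equidistant_sequence_radius_zero:
  fixes s :: "nat \<Rightarrow> 'a::banach"
  assumes nuc: "nearly_uniformly_convex TYPE('a)" and bdd: "bounded (range s)"
    and K: "convex K" "K \<noteq> {}"
    and radius: "\<And>v. v \<in> K \<Longrightarrow> asymptotic_radius s v = r"
    and cluster: "cluster_points weak_topology s \<subseteq> K"
    and mutual: "\<And>t. t > r \<Longrightarrow>
      eventually (\<lambda>n. eventually (\<lambda>m. norm (s m - s n) \<le> t) sequentially) sequentially"
  shows "r = 0"
proof (rule ccontr)
  assume "r \<noteq> 0"
  have "r \<ge> 0"
    using K(2) radius asymptotic_radius_nonneg[OF bdd] by (metis ex_in_conv)
  with \<open>r \<noteq> 0\<close> have r: "r > 0"
    by simp
  obtain U :: "nat filter" where U: "U \<le> sequentially" "ultrafilter U"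
    using ultrafilter_exists[of sequentially] by auto
  have U_bot: "U \<noteq> bot"
    using U(2) by (simp add: ultrafilter_def)
  have limit: "\<exists>w\<in>K. ((\<lambda>k. s (\<sigma> k)) \<longlongrightarrow> w) U" if "filterlim \<sigma> sequentially sequentially" for \<sigma>
    using equidistant_sequence_norm_limit[OF nuc bdd radius r cluster mutual U(2,1) that] by metis
  define \<Omega> where "\<Omega> = {u\<in>K. \<exists>\<sigma>. filterlim \<sigma> sequentially sequentially \<and> ((\<lambda>k. s (\<sigma> k)) \<longlongrightarrow> u) U}"
  have upper: "eventually (\<lambda>n. norm (s n - v) \<le> t) sequentially" if "v \<in> K" "t > r" for v t
    using asymptotic_radius_le_iff[OF bdd, of v r] radius that by simp
  have lower: "\<exists>n\<ge>k. norm (s n - v) > t" if "v \<in> K" "t < r" for v t k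
  proof (rule ccontr)
    assume "\<not> ?thesis"
    then have "eventually (\<lambda>n. norm (s n - v) \<le> t) sequentially"
      by (auto simp: eventually_sequentially not_less)
    then have "asymptotic_radius s v \<le> t"
      unfolding asymptotic_radius_le_iff[OF bdd] by (auto elim: eventually_mono)
    then show False
      using radius that by simp
  qed
  have \<Omega>_le: "norm (u - v) \<le> r" if u: "u \<in> \<Omega>" and v: "v \<in> K" for u v
  proof (rule dense_ge)
    fix t assume "t > r"
    obtain \<sigma> where \<sigma>: "filterlim \<sigma> sequentially sequentially" "((\<lambda>k. s (\<sigma> k)) \<longlongrightarrow> u) U"
      using u by (auto simp: \<Omega>_def)
    have "eventually (\<lambda>k. norm (s (\<sigma> k) - v) \<le> t) U"
      using eventually_compose_filterlim[OF upper[OF v \<open>t > r\<close>] \<sigma>(1)] U(1)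
      by (rule filter_leD[rotated])
    with tendsto_norm[OF tendsto_diff[OF \<sigma>(2) tendsto_const]] show "norm (u - v) \<le> t"
      using U_bot by (rule tendsto_upperbound)
  qed
  have far: "\<exists>u\<in>\<Omega>. norm (u - a) = r" if a: "a \<in> K" for a
  proof -
    have "\<exists>n\<ge>k. r - inverse (real (Suc k)) < norm (s n - a) \<and> norm (s n - a) \<le> r + inverse (real (Suc k))"
      for k
    proof -
      obtain N where N: "\<And>n. n \<ge> N \<Longrightarrow> norm (s n - a) \<le> r + inverse (real (Suc k))"
        using upper[OF a, of "r + inverse (real (Suc k))"] by (auto simp: eventually_sequentially)
      show ?thesis
        using lower[OF a, of "r - inverse (real (Suc k))" "max k N"] N by auto
    qed
    then obtain \<sigma> where \<sigma>: "\<And>k. \<sigma> k \<ge> k" "\<And>k. r - inverse (real (Suc k)) < norm (s (\<sigma> k) - a)"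
      "\<And>k. norm (s (\<sigma> k) - a) \<le> r + inverse (real (Suc k))"
      by metis
    have \<sigma>_lim: "filterlim \<sigma> sequentially sequentially"
      by (rule filterlim_at_top_mono[OF filterlim_ident]) (use \<sigma>(1) in auto)
    then obtain u where u: "u \<in> K" "((\<lambda>k. s (\<sigma> k)) \<longlongrightarrow> u) U"
      using limit by blast
    have "(\<lambda>k. norm (s (\<sigma> k) - a)) \<longlonglongrightarrow> r"
    proof (rule tendsto_sandwich)
      show "(\<lambda>k. r - inverse (real (Suc k))) \<longlonglongrightarrow> r"
        using LIMSEQ_inverse_real_of_nat_add_minus[of r] by simp
      show "(\<lambda>k. r + inverse (real (Suc k))) \<longlonglongrightarrow> r"
        by (rule LIMSEQ_inverse_real_of_nat_add)
    qed (use \<sigma>(2,3) in \<open>auto intro!: always_eventually less_imp_le\<close>)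
    then have "((\<lambda>k. norm (s (\<sigma> k) - a)) \<longlongrightarrow> r) U"
      using U(1) by (rule tendsto_mono[rotated])
    moreover have "((\<lambda>k. norm (s (\<sigma> k) - a)) \<longlongrightarrow> norm (u - a)) U"
      by (intro tendsto_intros u)
    ultimately have "norm (u - a) = r"
      using tendsto_unique[OF U_bot] by blast
    then show ?thesis
      using u \<sigma>_lim by (auto simp: \<Omega>_def)
  qed
  have extend: "\<exists>u\<in>\<Omega>. \<forall>f\<in>F. norm (u - f) = r" if F: "finite F" "F \<subseteq> \<Omega>" for F
  proof (cases "F = {}")
    case True
    then show ?thesis
      using far K(2) by blast
  next
    case False
    define N where "N = real (card F)"
    have N: "N > 0"
      using False F(1) by (simp add: N_def card_gt_0_iff)
    define a where "a = (\<Sum>f\<in>F. (1 / N) *\<^sub>R f)"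
    have "a \<in> K"
      unfolding a_def
      by (rule convex_sum[OF F(1) K(1)]) (use F N in \<open>auto simp: N_def \<Omega>_def\<close>)
    then obtain u where u: "u \<in> \<Omega>" "norm (u - a) = r"
      using far by blast
    have le: "norm (u - f) \<le> r" if "f \<in> F" for f
      using \<Omega>_le[OF u(1)] that F(2) by (auto simp: \<Omega>_def)
    have "N *\<^sub>R a = \<Sum>F"
      using N by (simp add: a_def scaleR_sum_right[symmetric])
    then have "N *\<^sub>R (u - a) = (\<Sum>f\<in>F. u - f)"
      by (simp add: sum_subtractf N_def scaleR_right_diff_distrib sum_constant_scaleR)
    then have "N * r = norm (\<Sum>f\<in>F. u - f)"
      using u(2) N by (metis abs_of_pos norm_scaleR)
    then have "N * r \<le> (\<Sum>f\<in>F. norm (u - f))"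
      using norm_sum[of "\<lambda>f. u - f" F] by simp
    then have "\<not> (\<Sum>f\<in>F. norm (u - f)) < (\<Sum>f\<in>F. r)"
      by (simp add: N_def)
    then have "norm (u - f) = r" if "f \<in> F" for f
      using sum_strict_mono_ex1[OF F(1), of "\<lambda>f. norm (u - f)" "\<lambda>_. r"] le that
      by (metis order_le_less)
    then show ?thesis
      using u(1) by blast
  qed
  have "\<exists>u :: nat \<Rightarrow> 'a. \<forall>k. u k \<in> \<Omega> \<and> (\<forall>j<k. norm (u k - u j) = r)"
  proof (rule dependent_wellorder_choice[where P = "\<lambda>u k v. v \<in> \<Omega> \<and> (\<forall>j<k. norm (v - u j) = r)"])
    fix k and u :: "nat \<Rightarrow> 'a"
    assume IH: "\<And>j. j < k \<Longrightarrow> u j \<in> \<Omega> \<and> (\<forall>i<j. norm (u j - u i) = r)"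
    then have "u ` {..<k} \<subseteq> \<Omega>"
      by auto
    then show "\<exists>v. v \<in> \<Omega> \<and> (\<forall>j<k. norm (v - u j) = r)"
      using extend[of "u ` {..<k}"] by auto
  qed auto
  then obtain u :: "nat \<Rightarrow> 'a" where u: "\<And>k. u k \<in> \<Omega>" "\<And>k j. j < k \<Longrightarrow> norm (u k - u j) = r"
    by blast
  have "\<exists>n\<ge>k. norm (s n - u k) < r / 4" for k
  proof -
    obtain \<sigma> where \<sigma>: "filterlim \<sigma> sequentially sequentially" "((\<lambda>j. s (\<sigma> j)) \<longlongrightarrow> u k) U"
      using u(1)[of k] by (auto simp: \<Omega>_def)
    have "eventually (\<lambda>j. norm (s (\<sigma> j) - u k) < r / 4) U"
      using tendstoD[OF \<sigma>(2), of "r / 4"] r by (simp add: dist_norm)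
    moreover have "eventually (\<lambda>j. \<sigma> j \<ge> k) U"
      using \<sigma>(1) U(1) by (auto simp: filterlim_at_top dest: filter_leD)
    ultimately have "eventually (\<lambda>j. \<sigma> j \<ge> k \<and> norm (s (\<sigma> j) - u k) < r / 4) U"
      by eventually_elim simp
    then show ?thesis
      using eventually_happens'[OF U_bot] by blast
  qed
  then obtain \<sigma> where \<sigma>: "\<And>k. \<sigma> k \<ge> k" "\<And>k. norm (s (\<sigma> k) - u k) < r / 4"
    by metis
  have "filterlim \<sigma> sequentially sequentially"
    by (rule filterlim_at_top_mono[OF filterlim_ident]) (use \<sigma>(1) in auto)
  then obtain w where "((\<lambda>k. s (\<sigma> k)) \<longlongrightarrow> w) U"
    using limit by blast
  then have ev: "eventually (\<lambda>k. norm (s (\<sigma> k) - w) < r / 4) U"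
    using tendstoD[of _ w U "r / 4"] r by (simp add: dist_norm)
  then obtain j where j: "norm (s (\<sigma> j) - w) < r / 4"
    using eventually_happens'[OF U_bot] by blast
  have "eventually (\<lambda>k. k > j) U"
    using eventually_gt_at_top U(1) by (rule filter_leD[rotated])
  with ev have "eventually (\<lambda>k. k > j \<and> norm (s (\<sigma> k) - w) < r / 4) U"
    by eventually_elim simp
  then obtain k where k: "k > j" "norm (s (\<sigma> k) - w) < r / 4"
    using eventually_happens'[OF U_bot] by blast
  have "dist (u k) (u j) \<le> dist (u k) (s (\<sigma> k)) + dist (s (\<sigma> k)) w + dist w (s (\<sigma> j)) + dist (s (\<sigma> j)) (u j)"
    by (metric)
  also have "\<dots> < r"
    using j k(2) \<sigma>(2)[of j] \<sigma>(2)[of k] by (simp add: dist_norm norm_minus_commute)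
  finally show False
    using u(2)[OF k(1)] by (simp add: dist_norm)
qed

section \<open>Mappings of asymptotically nonexpansive type\<close>

lemma funpow_in_self_map:
  assumes "T \<in> C \<rightarrow> C" "x \<in> C"
  shows "(T ^^ n) x \<in> C"
  using assms by (induction n) auto

lemma bounded_orbit:
  assumes "T \<in> C \<rightarrow> C" "x \<in> C" "bounded C"
  shows "bounded (range (\<lambda>n. (T ^^ n) x))"
  by (rule bounded_subset[OF assms(3)]) (auto intro: funpow_in_self_map[OF assms(1,2)])

lemma asymptotically_nonexpansive_typeD:
  assumes "asymptotically_nonexpansive_type C T" "x \<in> C" "\<delta> > 0"
  obtains N where
    "\<And>n y. n \<ge> N \<Longrightarrow> y \<in> C \<Longrightarrow> norm ((T ^^ n) x - (T ^^ n) y) \<le> norm (x - y) + \<delta>"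
proof -
  let ?f = "\<lambda>n y. ereal (norm ((T ^^ n) x - (T ^^ n) y) - norm (x - y))"
  have "limsup (\<lambda>n. SUP y\<in>C. ?f n y) \<le> 0"
    using assms by (simp add: asymptotically_nonexpansive_type_def)
  also have "0 < ereal \<delta>"
    using assms(3) by simp
  finally have "eventually (\<lambda>n. (SUP y\<in>C. ?f n y) < ereal \<delta>) sequentially"
    by (rule Limsup_lessD)
  then obtain N where N: "\<And>n. n \<ge> N \<Longrightarrow> (SUP y\<in>C. ?f n y) < ereal \<delta>"
    by (auto simp: eventually_sequentially)
  show thesis
  proof (rule that)
    fix n y assume "n \<ge> N" "y \<in> C"
    have "?f n y \<le> (SUP y\<in>C. ?f n y)"
      using \<open>y \<in> C\<close> by (rule SUP_upper)
    also have "\<dots> < ereal \<delta>"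
      using N[OF \<open>n \<ge> N\<close>] .
    finally show "norm ((T ^^ n) x - (T ^^ n) y) \<le> norm (x - y) + \<delta>"
      by simp
  qed
qed

text \<open>For \<open>m \<ge> n\<close> the distance from \<open>(T ^^ m) x\<close> to \<open>(T ^^ n) u\<close> exceeds that from
  \<open>(T ^^ (m - n)) x\<close> to \<open>u\<close> at most by an amount that is independent of \<open>m\<close> and tends to 0 as \<open>n\<close>
  grows.\<close>

lemma asymptotic_radius_along_orbit:
  assumes T: "T \<in> C \<rightarrow> C" and ant: "asymptotically_nonexpansive_type C T" and "bounded C"
    and "x \<in> C" "u \<in> C" and u: "asymptotic_radius (\<lambda>n. (T ^^ n) x) u \<le> r" and t: "t > r"
  shows "eventually (\<lambda>n. asymptotic_radius (\<lambda>m. (T ^^ m) x) ((T ^^ n) u) \<le> t) sequentially"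
proof -
  note bdd = bounded_orbit[OF T \<open>x \<in> C\<close> \<open>bounded C\<close>]
  obtain N where N: "\<And>n y. n \<ge> N \<Longrightarrow> y \<in> C \<Longrightarrow>
      norm ((T ^^ n) u - (T ^^ n) y) \<le> norm (u - y) + (t - r) / 2"
    using asymptotically_nonexpansive_typeD[OF ant \<open>u \<in> C\<close>, of "(t - r) / 2"] t by auto
  have "r < r + (t - r) / 2"
    using t by simp
  then obtain M where M: "\<And>m. m \<ge> M \<Longrightarrow> norm ((T ^^ m) x - u) \<le> r + (t - r) / 2"
    using u unfolding asymptotic_radius_le_iff[OF bdd] eventually_sequentially by blast
  have "asymptotic_radius (\<lambda>m. (T ^^ m) x) ((T ^^ n) u) \<le> t" if "n \<ge> N" for n
  proof -
    have "norm ((T ^^ m) x - (T ^^ n) u) \<le> t" if "m \<ge> M + n" for m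
    proof -
      have "(T ^^ m) x = (T ^^ n) ((T ^^ (m - n)) x)"
        using that by (simp add: funpow_add[THEN fun_cong, symmetric, unfolded o_def])
      then have "norm ((T ^^ m) x - (T ^^ n) u) \<le> norm ((T ^^ (m - n)) x - u) + (t - r) / 2"
        using N[OF \<open>n \<ge> N\<close>, of "(T ^^ (m - n)) x"] funpow_in_self_map[OF T \<open>x \<in> C\<close>]
        by (simp add: norm_minus_commute)
      also have "\<dots> \<le> t"
        using M[of "m - n"] that by (simp add: field_simps)
      finally show ?thesis .
    qed
    then have "eventually (\<lambda>m. norm ((T ^^ m) x - (T ^^ n) u) \<le> t) sequentially"
      unfolding eventually_sequentially by blast
    then show ?thesis
      unfolding asymptotic_radius_le_iff[OF bdd] by (auto elim: eventually_mono)
  qed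
  then show ?thesis
    unfolding eventually_sequentially by blast
qed

text \<open>By the previous lemma the sublevel sets of the asymptotic radius of an orbit inherit the
  closedness under weak limits, so a minimal \<open>K\<close> coincides with each of them that it meets.\<close>

lemma asymptotic_radius_constant_on_minimal:
  assumes T: "T \<in> C \<rightarrow> C" and ant: "asymptotically_nonexpansive_type C T" and "bounded C"
    and K: "weak_omega_closed_convex C T K"
    and min: "\<And>K'. weak_omega_closed_convex C T K' \<Longrightarrow> K' \<subseteq> K \<Longrightarrow> K' = K"
    and "x \<in> C" "u \<in> K" "v \<in> K"
  shows "asymptotic_radius (\<lambda>n. (T ^^ n) x) u = asymptotic_radius (\<lambda>n. (T ^^ n) x) v"
proof -
  define h where "h = asymptotic_radius (\<lambda>n. (T ^^ n) x)"
  note bdd = bounded_orbit[OF T \<open>x \<in> C\<close> \<open>bounded C\<close>]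
  have KC: "K \<subseteq> C"
    using K by (simp add: weak_omega_closed_convex_def)
  have "h v \<le> h u" if "u \<in> K" "v \<in> K" for u v
  proof -
    define K' where "K' = K \<inter> {z. h z \<le> h u}"
    have "weak_omega_limit T z \<subseteq> K'" if z: "z \<in> K'" for z
    proof
      fix w assume w: "w \<in> weak_omega_limit T z"
      have "h w \<le> t" if "t > h u" for t
      proof -
        have "eventually (\<lambda>n. h ((T ^^ n) z) \<le> t) sequentially"
          using asymptotic_radius_along_orbit[OF T ant \<open>bounded C\<close> \<open>x \<in> C\<close>, of z "h u" t] z KC that
          by (auto simp: K'_def h_def)
        then have "w \<in> {z. h z \<le> t}"
          using weak_cluster_point_in_closed_convex[of w "\<lambda>n. (T ^^ n) z" "{z. h z \<le> t}"] w
            closed_asymptotic_radius_sublevel[OF bdd] convex_asymptotic_radius_sublevel[OF bdd]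
          by (simp add: weak_omega_limit_def h_def)
        then show ?thesis
          by simp
      qed
      then have "h w \<le> h u"
        by (rule dense_ge)
      moreover have "w \<in> K"
        using w z K by (auto simp: K'_def weak_omega_closed_convex_def)
      ultimately show "w \<in> K'"
        by (simp add: K'_def)
    qed
    moreover have "closed K'" "convex K'"
      using K closed_asymptotic_radius_sublevel[OF bdd] convex_asymptotic_radius_sublevel[OF bdd]
      by (auto simp: K'_def h_def weak_omega_closed_convex_def intro!: convex_Int)
    moreover have "K' \<subseteq> C" "K' \<noteq> {}"
      using KC \<open>u \<in> K\<close> by (auto simp: K'_def)
    ultimately have "weak_omega_closed_convex C T K'"
      by (simp add: weak_omega_closed_convex_def)
    then have "K' = K"
      by (rule min) (auto simp: K'_def)
    then show ?thesis
      using \<open>v \<in> K\<close> by (auto simp: K'_def)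
  qed
  then show ?thesis
    using \<open>u \<in> K\<close> \<open>v \<in> K\<close> by (simp add: h_def order_antisym)
qed

text \<open>The orbit of a point \<open>x\<close> of \<open>K\<close> is asymptotically equidistant from \<open>K\<close>, and its terms are no
  further from each other since, for large \<open>n\<close>, \<open>(T ^^ m) x\<close> and \<open>(T ^^ n) x\<close> are hardly further
  apart than \<open>(T ^^ (m - n)) x\<close> and \<open>x\<close>.\<close>

lemma minimal_weak_omega_closed_convex_singleton:
  fixes C :: "'a::banach set"
  assumes nuc: "nearly_uniformly_convex TYPE('a)" and "bounded C"
    and T: "T \<in> C \<rightarrow> C" and ant: "asymptotically_nonexpansive_type C T"
    and K: "weak_omega_closed_convex C T K"
    and min: "\<And>K'. weak_omega_closed_convex C T K' \<Longrightarrow> K' \<subseteq> K \<Longrightarrow> K' = K"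
  obtains x where "K = {x}" "(\<lambda>n. (T ^^ n) x) \<longlonglongrightarrow> x"
proof -
  obtain x where x: "x \<in> K"
    using K by (auto simp: weak_omega_closed_convex_def)
  then have xC: "x \<in> C"
    using K by (auto simp: weak_omega_closed_convex_def)
  define s where "s = (\<lambda>n. (T ^^ n) x)"
  define r where "r = asymptotic_radius s x"
  have sC: "s n \<in> C" for n
    unfolding s_def by (rule funpow_in_self_map[OF T xC])
  have bdd: "bounded (range s)"
    unfolding s_def by (rule bounded_orbit[OF T xC \<open>bounded C\<close>])
  have radius: "asymptotic_radius s v = r" if "v \<in> K" for v
    unfolding r_def s_def
    using asymptotic_radius_constant_on_minimal[OF T ant \<open>bounded C\<close> K min xC that x] by blast
  have "r = 0"
  proof (rule equidistant_sequence_radius_zero[OF nuc bdd])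
    show "convex K" "K \<noteq> {}" "cluster_points weak_topology s \<subseteq> K"
      using K x by (auto simp: weak_omega_closed_convex_def weak_omega_limit_def s_def)
    show "asymptotic_radius s v = r" if "v \<in> K" for v
      using radius[OF that] .
    fix t assume t: "t > r"
    obtain N where N: "\<And>n y. n \<ge> N \<Longrightarrow> y \<in> C \<Longrightarrow>
        norm ((T ^^ n) x - (T ^^ n) y) \<le> norm (x - y) + (t - r) / 2"
      using asymptotically_nonexpansive_typeD[OF ant xC, of "(t - r) / 2"] t by auto
    have "r < r + (t - r) / 2"
      using t by simp
    then obtain M where M: "\<And>m. m \<ge> M \<Longrightarrow> norm (s m - x) \<le> r + (t - r) / 2"
      using asymptotic_radius_le_iff[OF bdd, of x r] unfolding r_def eventually_sequentially by blast
    have "norm (s m - s n) \<le> t" if "n \<ge> N" "m \<ge> M + n" for m n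
    proof -
      have "s m = (T ^^ n) (s (m - n))"
        using that by (simp add: s_def funpow_add[THEN fun_cong, symmetric, unfolded o_def])
      then have "norm (s m - s n) \<le> norm (s (m - n) - x) + (t - r) / 2"
        using N[OF \<open>n \<ge> N\<close> sC, of "m - n"] by (simp add: norm_minus_commute s_def)
      also have "\<dots> \<le> t"
        using M[of "m - n"] that by (simp add: field_simps)
      finally show ?thesis .
    qed
    then show "eventually (\<lambda>n. eventually (\<lambda>m. norm (s m - s n) \<le> t) sequentially) sequentially"
      unfolding eventually_sequentially by blast
  qed
  have lim: "s \<longlonglongrightarrow> v" if "v \<in> K" for v
  proof (rule tendstoI)
    fix e :: real assume "e > 0"
    then have "eventually (\<lambda>n. norm (s n - v) \<le> e / 2) sequentially"
      using radius[OF that] \<open>r = 0\<close> asymptotic_radius_le_iff[OF bdd, of v 0] half_gt_zero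
      by (metis order_refl)
    then show "eventually (\<lambda>n. dist (s n) v < e) sequentially"
      by eventually_elim (use \<open>e > 0\<close> in \<open>simp add: dist_norm\<close>)
  qed
  then have "K = {x}"
    using x LIMSEQ_unique by blast
  then show thesis
    using that lim[OF x] by (simp add: s_def)
qed

lemma minimal_weak_omega_closed_convex_exists:
  fixes C :: "'a::banach set"
  assumes nuc: "nearly_uniformly_convex TYPE('a)"
    and C: "closed C" "convex C" "bounded C" "C \<noteq> {}" and T: "T \<in> C \<rightarrow> C"
  obtains K where "weak_omega_closed_convex C T K"
    "\<And>K'. weak_omega_closed_convex C T K' \<Longrightarrow> K' \<subseteq> K \<Longrightarrow> K' = K"
proof -
  define A where "A = {K. weak_omega_closed_convex C T K}"
  define P where "P = (\<lambda>K K' :: 'a set. K' \<subseteq> K)"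
  have "weak_omega_limit T x \<subseteq> C" if "x \<in> C" for x
    using weak_cluster_point_in_closed_convex[OF _ C(1,2)] funpow_in_self_map[OF T that]
    by (auto simp: weak_omega_limit_def)
  then have "C \<in> A"
    using C by (simp add: A_def weak_omega_closed_convex_def)
  have "\<exists>K\<in>A. \<forall>K'\<in>\<C>. P K' K" if ch: "\<C> \<in> Chains (relation_of P A)" for \<C>
  proof (cases "\<C> = {}")
    case True
    then show ?thesis using \<open>C \<in> A\<close> by auto
  next
    case False
    have CA: "weak_omega_closed_convex C T K" if "K \<in> \<C>" for K
      using ch that by (auto simp: Chains_def relation_of_def A_def)
    have lin: "K \<subseteq> K' \<or> K' \<subseteq> K" if "K \<in> \<C>" "K' \<in> \<C>" for K K'
      using ch that by (auto simp: Chains_def relation_of_def P_def)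
    have "\<Inter>\<C> \<noteq> {}"
    proof (rule nuc_directed_intersection[OF nuc False])
      show "bounded C" by (rule C(3))
      show "{} \<notin> \<C>" "\<And>K. K \<in> \<C> \<Longrightarrow> closed K \<and> convex K \<and> K \<subseteq> C"
        using CA by (auto simp: weak_omega_closed_convex_def)
      show "\<exists>D\<in>\<C>. D \<subseteq> K \<inter> K'" if "K \<in> \<C>" "K' \<in> \<C>" for K K'
        using lin[OF that] that by blast
    qed
    moreover have "\<Inter>\<C> \<subseteq> C"
      using False CA by (intro Inter_subset) (auto simp: weak_omega_closed_convex_def)
    moreover have "closed (\<Inter>\<C>)" "convex (\<Inter>\<C>)"
      using CA by (auto simp: weak_omega_closed_convex_def intro: convex_Inter)
    moreover have "weak_omega_limit T x \<subseteq> \<Inter>\<C>" if "x \<in> \<Inter>\<C>" for x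
      using CA that by (auto simp: weak_omega_closed_convex_def)
    ultimately have "\<Inter>\<C> \<in> A"
      by (simp add: A_def weak_omega_closed_convex_def)
    then show ?thesis
      by (auto simp: P_def)
  qed
  moreover have "partial_order_on A (relation_of P A)"
    by (auto simp: partial_order_on_def preorder_on_def refl_on_def trans_def antisym_def
        relation_of_def P_def)
  ultimately obtain K where "K \<in> A" "\<And>K'. K' \<in> A \<Longrightarrow> K' \<subseteq> K \<Longrightarrow> K' = K"
    using predicate_Zorn[of A P] by (auto simp: P_def)
  then show thesis
    using that by (simp add: A_def)
qed

section \<open>Pointwise asymptotically nonexpansive mappings\<close>

lemma pointwise_imp_asymptotically_nonexpansive_type:
  assumes pw: "pointwise_asymptotically_nonexpansive C T" and "bounded C"
  shows "asymptotically_nonexpansive_type C T"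
  unfolding asymptotically_nonexpansive_type_def
proof
  fix x assume "x \<in> C"
  then obtain N a where a: "a \<longlonglongrightarrow> (1::real)"
    and N: "\<And>n y. n \<ge> N \<Longrightarrow> y \<in> C \<Longrightarrow> norm ((T ^^ n) x - (T ^^ n) y) \<le> a n * norm (x - y)"
    using pw unfolding pointwise_asymptotically_nonexpansive_def by blast
  obtain D where D: "D \<ge> 0" "\<And>y. y \<in> C \<Longrightarrow> norm (x - y) \<le> D"
  proof (rule that)
    show "diameter C \<ge> 0"
      by (rule diameter_ge_0[OF \<open>bounded C\<close>])
    show "norm (x - y) \<le> diameter C" if "y \<in> C" for y
      using diameter_bounded_bound[OF \<open>bounded C\<close> \<open>x \<in> C\<close> that] by (simp add: dist_norm)
  qed
  let ?F = "\<lambda>n. SUP y\<in>C. ereal (norm ((T ^^ n) x - (T ^^ n) y) - norm (x - y))"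
  have "?F n \<le> ereal (\<bar>a n - 1\<bar> * D)" if "n \<ge> N" for n
  proof (rule SUP_least)
    fix y assume "y \<in> C"
    have "norm ((T ^^ n) x - (T ^^ n) y) - norm (x - y) \<le> (a n - 1) * norm (x - y)"
      using N[OF that \<open>y \<in> C\<close>] by (simp add: algebra_simps)
    also have "\<dots> \<le> \<bar>a n - 1\<bar> * D"
      using D \<open>y \<in> C\<close> by (intro mult_mono) auto
    finally show "ereal (norm ((T ^^ n) x - (T ^^ n) y) - norm (x - y)) \<le> ereal (\<bar>a n - 1\<bar> * D)"
      by simp
  qed
  then have "limsup ?F \<le> limsup (\<lambda>n. ereal (\<bar>a n - 1\<bar> * D))"
    by (intro Limsup_mono) (auto simp: eventually_sequentially)
  moreover have "(\<lambda>n. \<bar>a n - 1\<bar> * D) \<longlonglongrightarrow> \<bar>1 - 1\<bar> * D"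
    by (intro tendsto_intros a)
  then have "(\<lambda>n. ereal (\<bar>a n - 1\<bar> * D)) \<longlonglongrightarrow> 0"
    by (simp add: zero_ereal_def)
  then have "limsup (\<lambda>n. ereal (\<bar>a n - 1\<bar> * D)) = 0"
    by (intro lim_imp_Limsup) auto
  ultimately show "limsup ?F \<le> 0"
    by simp
qed

text \<open>The iterates \<open>T ^^ m\<close> with \<open>m\<close> large are continuous at \<open>x\<close>, and therefore fix the limit \<open>x\<close> of
  the orbit; two consecutive ones determine \<open>T x\<close>.\<close>

lemma orbit_limit_is_fixed_point:
  assumes T: "T \<in> C \<rightarrow> C" and pw: "pointwise_asymptotically_nonexpansive C T"
    and x: "x \<in> C" and lim: "(\<lambda>n. (T ^^ n) x) \<longlonglongrightarrow> x"
  shows "T x = x"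
proof -
  obtain N a where N: "\<And>n y. n \<ge> N \<Longrightarrow> y \<in> C \<Longrightarrow>
      norm ((T ^^ n) x - (T ^^ n) y) \<le> a n * norm (x - y)"
    using pw x unfolding pointwise_asymptotically_nonexpansive_def by blast
  have fix_pt: "(T ^^ m) x = x" if "m \<ge> N" for m
  proof -
    have "(\<lambda>n. a m * norm (x - (T ^^ n) x)) \<longlonglongrightarrow> a m * norm (x - x)"
      by (intro tendsto_intros lim)
    then have null: "(\<lambda>n. a m * norm (x - (T ^^ n) x)) \<longlonglongrightarrow> 0"
      by simp
    have "norm ((T ^^ (n + m)) x - (T ^^ m) x) \<le> a m * norm (x - (T ^^ n) x)" for n
      using N[OF that funpow_in_self_map[OF T x], of n]
      by (simp add: norm_minus_commute funpow_add add.commute)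
    then have "(\<lambda>n. (T ^^ (n + m)) x - (T ^^ m) x) \<longlonglongrightarrow> 0"
      by (intro Lim_null_comparison[OF _ null] always_eventually allI)
    then have "(\<lambda>n. (T ^^ (n + m)) x) \<longlonglongrightarrow> (T ^^ m) x"
      by (rule LIM_zero_cancel)
    moreover have "(\<lambda>n. (T ^^ (n + m)) x) \<longlonglongrightarrow> x"
      using lim by (rule LIMSEQ_ignore_initial_segment)
    ultimately show ?thesis
      by (rule LIMSEQ_unique)
  qed
  have "T x = T ((T ^^ N) x)"
    by (simp add: fix_pt)
  also have "\<dots> = (T ^^ Suc N) x"
    by simp
  also have "\<dots> = x"
    by (rule fix_pt) simp
  finally show ?thesis .
qed

theorem theorem5p7:
  fixes C :: "'a::banach set"
  assumes "nearly_uniformly_convex TYPE('a)"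
    and "closed C" and "convex C" and "bounded C" and "C \<noteq> {}"
  shows "(\<forall>T K. T \<in> C \<rightarrow> C \<longrightarrow> asymptotically_nonexpansive_type C T \<longrightarrow>
            weak_omega_closed_convex C T K \<longrightarrow>
            (\<forall>K'. weak_omega_closed_convex C T K' \<and> K' \<subseteq> K \<longrightarrow> K' = K) \<longrightarrow>
            (\<exists>x0. K = {x0} \<and> (\<lambda>n. (T ^^ n) x0) \<longlonglongrightarrow> x0))
       \<and> (\<forall>T. T \<in> C \<rightarrow> C \<longrightarrow> pointwise_asymptotically_nonexpansive C T \<longrightarrow>
            (\<exists>x\<in>C. T x = x))"
proof (intro conjI allI impI)
  fix T K
  assume "T \<in> C \<rightarrow> C" "asymptotically_nonexpansive_type C T" "weak_omega_closed_convex C T K"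
    and min: "\<forall>K'. weak_omega_closed_convex C T K' \<and> K' \<subseteq> K \<longrightarrow> K' = K"
  then obtain x where "K = {x}" "(\<lambda>n. (T ^^ n) x) \<longlonglongrightarrow> x"
    using minimal_weak_omega_closed_convex_singleton[OF assms(1,4)] by metis
  then show "\<exists>x0. K = {x0} \<and> (\<lambda>n. (T ^^ n) x0) \<longlonglongrightarrow> x0"
    by blast
next
  fix T
  assume T: "T \<in> C \<rightarrow> C" and pw: "pointwise_asymptotically_nonexpansive C T"
  have ant: "asymptotically_nonexpansive_type C T"
    using pw assms(4) by (rule pointwise_imp_asymptotically_nonexpansive_type)
  obtain K where K: "weak_omega_closed_convex C T K"
    and min: "\<And>K'. weak_omega_closed_convex C T K' \<Longrightarrow> K' \<subseteq> K \<Longrightarrow> K' = K"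
    using minimal_weak_omega_closed_convex_exists[OF assms T] by metis
  obtain x where x: "K = {x}" "(\<lambda>n. (T ^^ n) x) \<longlonglongrightarrow> x"
    using minimal_weak_omega_closed_convex_singleton[OF assms(1,4) T ant K min] by metis
  then have "x \<in> C"
    using K by (simp add: weak_omega_closed_convex_def)
  then show "\<exists>x\<in>C. T x = x"
    using orbit_limit_is_fixed_point[OF T pw] x(2) by blast
qed

end
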